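(* (In $\mathbf{ZF}$.) Let $\mathbf{X}$ be a zero-dimensional $T_1$-space. Let $\{\mathbf{S}_n: n\in\omega\}$ be a family of $c_{\delta}$-embedded $\mathbb{N}$-compact subspaces of $\mathbf{X}$ such that $X=\bigcup_{n\in\omega}S_n$. Then $\mathbf{CMC}$ implies that $\mathbf{X}$ is $\mathbb{N}$-compact.
   Context: The base theory is $\mathbf{ZF}$ (the Axiom of Choice is not assumed). $\mathbf{CMC}$ is the statement: for every family $\{A_n:n\in\omega\}$ of non-empty sets there is a function assigning to each $n\in\omega$ a non-empty finite subset of $A_n$. A space is zero-dimensional if its clopen sets form a base. A space is $\mathbb{N}$-compact if for some non-empty set $J$ it is homeomorphic with a closed subspace of $\mathbb{N}^J$, where $\mathbb{N}$ carries the discrete topology. $\mathcal{CO}_\delta(\mathbf{X})$ is the family of all intersections of non-empty countable families of clopen subsets of $\mathbf{X}$. A subspace $\mathbf{S}$ of $\mathbf{X}$ (with underlying set $S$) is $c_\delta$-embedded in $\mathbf{X}$ if for every $A\in\mathcal{CO}_\delta(\mathbf{S})$ there is $B\in\mathcal{CO}_\delta(\mathbf{X})$ with $A=B\cap S$. *)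

theory Defs
  imports Main
begin

text \<open>
  The logic HOL contains a choice operator, so a theorem of ZF about arbitrary sets cannot be
  rendered by HOL sets and types without importing the Axiom of Choice.  We therefore work inside an
  arbitrary first-order structure \<open>(V, E)\<close> for the language of set theory: \<open>V\<close> is a HOL type
  \<open>'v\<close> and \<open>E\<close> a binary relation on it.  By soundness and completeness of first-order logic, a
  sentence is a theorem of ZF iff it holds in every such structure that satisfies the axioms of ZF.

  Sets, functions, families, topologies, the set \<open>\<omega>\<close>, finiteness and countability are all those
  of the structure: every quantifier below ranges over \<open>'v\<close>.  A term of type \<open>'v set\<close> only
  occurs as a class given by a first-order formula over \<open>E\<close>.
\<close>


subsection \<open>First-order formulas over a membership relation\<close>

datatype fm = Mem nat nat | Eq nat nat | Neg fm | Conj fm fm | All nat fm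

primrec sat :: "('v \<Rightarrow> 'v \<Rightarrow> bool) \<Rightarrow> fm \<Rightarrow> (nat \<Rightarrow> 'v) \<Rightarrow> bool" where
  "sat E (Mem i j) s \<longleftrightarrow> E (s i) (s j)"
| "sat E (Eq i j) s \<longleftrightarrow> s i = s j"
| "sat E (Neg p) s \<longleftrightarrow> \<not> sat E p s"
| "sat E (Conj p q) s \<longleftrightarrow> sat E p s \<and> sat E q s"
| "sat E (All i p) s \<longleftrightarrow> (\<forall>a. sat E p (s(i := a)))"


subsection \<open>Set-theoretic vocabulary\<close>

locale membership =
  fixes E :: "'v \<Rightarrow> 'v \<Rightarrow> bool"
begin

definition elts :: "'v \<Rightarrow> 'v set" where
  "elts x = {z. E z x}"

text \<open>The element of the structure whose extension is the class \<open>B\<close>; in a model of ZF it exists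
  and is unique at each use below.\<close>

definition set_of :: "'v set \<Rightarrow> 'v" where
  "set_of B = (THE x. elts x = B)"

definition empty :: 'v where
  "empty = set_of {}"

definition opair :: "'v \<Rightarrow> 'v \<Rightarrow> 'v" where
  "opair a b = set_of {set_of {a}, set_of {a, b}}"

definition is_function :: "'v \<Rightarrow> 'v \<Rightarrow> bool" where
  "is_function f A \<longleftrightarrow>
     (\<forall>p\<in>elts f. \<exists>x\<in>elts A. \<exists>y. p = opair x y) \<and>
     (\<forall>x\<in>elts A. \<exists>!y. opair x y \<in> elts f)"

definition app :: "'v \<Rightarrow> 'v \<Rightarrow> 'v" where
  "app f x = (THE y. opair x y \<in> elts f)"

definition maps :: "'v \<Rightarrow> 'v \<Rightarrow> 'v \<Rightarrow> bool" where
  "maps f A B \<longleftrightarrow> is_function f A \<and> (\<forall>x\<in>elts A. app f x \<in> elts B)"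

definition injective :: "'v \<Rightarrow> 'v \<Rightarrow> bool" where
  "injective f A \<longleftrightarrow> (\<forall>x\<in>elts A. \<forall>y\<in>elts A. app f x = app f y \<longrightarrow> x = y)"

definition surjective :: "'v \<Rightarrow> 'v \<Rightarrow> 'v \<Rightarrow> bool" where
  "surjective f A B \<longleftrightarrow> (\<forall>y\<in>elts B. \<exists>x\<in>elts A. app f x = y)"

definition is_inductive :: "'v \<Rightarrow> bool" where
  "is_inductive I \<longleftrightarrow>
     empty \<in> elts I \<and> (\<forall>n\<in>elts I. set_of (insert n (elts n)) \<in> elts I)"

definition omega :: 'v where
  "omega = set_of {n. \<forall>I. is_inductive I \<longrightarrow> n \<in> elts I}"

text \<open>Finite and countable in the sense of the structure, not of HOL.\<close>

definition fin :: "'v \<Rightarrow> bool" where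
  "fin A \<longleftrightarrow> (\<exists>n\<in>elts omega. \<exists>f. maps f n A \<and> injective f n \<and> surjective f n A)"

definition ctble :: "'v \<Rightarrow> bool" where
  "ctble A \<longleftrightarrow> (\<exists>f. maps f A omega \<and> injective f A)"

definition CMC :: bool where
  "CMC \<longleftrightarrow>
     (\<forall>A. is_function A omega \<and> (\<forall>n\<in>elts omega. elts (app A n) \<noteq> {}) \<longrightarrow>
       (\<exists>F. is_function F omega \<and>
         (\<forall>n\<in>elts omega.
            elts (app F n) \<subseteq> elts (app A n) \<and> elts (app F n) \<noteq> {} \<and> fin (app F n))))"


subsection \<open>Topological vocabulary\<close>

definition topological_space :: "'v \<Rightarrow> 'v \<Rightarrow> bool" where
  "topological_space X T \<longleftrightarrow>
     (\<forall>U\<in>elts T. elts U \<subseteq> elts X) \<and>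
     empty \<in> elts T \<and> X \<in> elts T \<and>
     (\<forall>U\<in>elts T. \<forall>V\<in>elts T. set_of (elts U \<inter> elts V) \<in> elts T) \<and>
     (\<forall>\<U>. elts \<U> \<subseteq> elts T \<longrightarrow> set_of (\<Union>U\<in>elts \<U>. elts U) \<in> elts T)"

definition closed_in :: "'v \<Rightarrow> 'v \<Rightarrow> 'v \<Rightarrow> bool" where
  "closed_in X T C \<longleftrightarrow> elts C \<subseteq> elts X \<and> set_of (elts X - elts C) \<in> elts T"

definition clopen :: "'v \<Rightarrow> 'v \<Rightarrow> 'v \<Rightarrow> bool" where
  "clopen X T C \<longleftrightarrow> C \<in> elts T \<and> closed_in X T C"

definition T1_space :: "'v \<Rightarrow> 'v \<Rightarrow> bool" where
  "T1_space X T \<longleftrightarrow> topological_space X T \<and>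
     (\<forall>x\<in>elts X. \<forall>y\<in>elts X. x \<noteq> y \<longrightarrow> (\<exists>U\<in>elts T. x \<in> elts U \<and> y \<notin> elts U))"

definition is_base :: "'v set \<Rightarrow> 'v \<Rightarrow> bool" where
  "is_base \<B> T \<longleftrightarrow> \<B> \<subseteq> elts T \<and>
     (\<forall>U\<in>elts T. \<exists>\<U>. elts \<U> \<subseteq> \<B> \<and> elts U = (\<Union>B\<in>elts \<U>. elts B))"

definition zero_dimensional :: "'v \<Rightarrow> 'v \<Rightarrow> bool" where
  "zero_dimensional X T \<longleftrightarrow> topological_space X T \<and> is_base {C. clopen X T C} T"

definition subspace :: "'v \<Rightarrow> 'v \<Rightarrow> 'v" where
  "subspace T S = set_of {V. \<exists>U\<in>elts T. elts V = elts U \<inter> elts S}"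

definition continuous :: "'v \<Rightarrow> 'v \<Rightarrow> 'v \<Rightarrow> 'v \<Rightarrow> 'v \<Rightarrow> bool" where
  "continuous f X T Y T' \<longleftrightarrow> maps f X Y \<and>
     (\<forall>V\<in>elts T'. set_of {x \<in> elts X. app f x \<in> elts V} \<in> elts T)"

definition homeomorphic :: "'v \<Rightarrow> 'v \<Rightarrow> 'v \<Rightarrow> 'v \<Rightarrow> bool" where
  "homeomorphic X T Y T' \<longleftrightarrow>
     (\<exists>f g. continuous f X T Y T' \<and> continuous g Y T' X T \<and>
        (\<forall>x\<in>elts X. app g (app f x) = x) \<and> (\<forall>y\<in>elts Y. app f (app g y) = y))"

definition discrete :: "'v \<Rightarrow> 'v" where
  "discrete Y = set_of {U. elts U \<subseteq> elts Y}"

text \<open>The power of a space \<open>(Y, T)\<close> with exponent \<open>J\<close>, under the product (Tychonoff)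
  topology.  A basic open set \<open>box Y J K u\<close> restricts the coordinates in the finite set
  \<open>K \<subseteq> J\<close>, the coordinate \<open>j\<close> to the open set \<open>app u j\<close>.\<close>

definition power_space :: "'v \<Rightarrow> 'v \<Rightarrow> 'v" where
  "power_space Y J = set_of {g. maps g J Y}"

definition box :: "'v \<Rightarrow> 'v \<Rightarrow> 'v \<Rightarrow> 'v \<Rightarrow> 'v" where
  "box Y J K u = set_of {g \<in> elts (power_space Y J). \<forall>j\<in>elts K. app g j \<in> elts (app u j)}"

definition power_topology :: "'v \<Rightarrow> 'v \<Rightarrow> 'v \<Rightarrow> 'v" where
  "power_topology Y T J = set_of {W. \<exists>\<U>.
     elts \<U> \<subseteq> {box Y J K u | K u. elts K \<subseteq> elts J \<and> fin K \<and> maps u K T} \<and>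
     elts W = (\<Union>B\<in>elts \<U>. elts B)}"

definition N_compact :: "'v \<Rightarrow> 'v \<Rightarrow> bool" where
  "N_compact X T \<longleftrightarrow>
     (\<exists>J C. elts J \<noteq> {} \<and>
        closed_in (power_space omega J) (power_topology omega (discrete omega) J) C \<and>
        homeomorphic X T C (subspace (power_topology omega (discrete omega) J) C))"

definition CO_delta :: "'v \<Rightarrow> 'v \<Rightarrow> 'v set" where
  "CO_delta X T = {A. \<exists>\<C>. elts \<C> \<noteq> {} \<and> ctble \<C> \<and> elts \<C> \<subseteq> {C. clopen X T C} \<and>
     elts A = (\<Inter>C\<in>elts \<C>. elts C)}"

definition c_delta_embedded :: "'v \<Rightarrow> 'v \<Rightarrow> 'v \<Rightarrow> bool" where
  "c_delta_embedded X T S \<longleftrightarrow> elts S \<subseteq> elts X \<and>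
     (\<forall>A\<in>CO_delta S (subspace T S). \<exists>B\<in>CO_delta X T. elts A = elts B \<inter> elts S)"

end


subsection \<open>Models of ZF\<close>

text \<open>In the two schemes \<open>p\<close> ranges over all formulas; the variables 0 (and 1 in replacement) are
  the arguments, and the other values of the assignment \<open>s\<close> are parameters.\<close>

locale ZF = membership E for E :: "'v \<Rightarrow> 'v \<Rightarrow> bool" +
  assumes extensionality: "elts x = elts y \<Longrightarrow> x = y"
    and foundation: "elts x \<noteq> {} \<Longrightarrow> \<exists>y\<in>elts x. elts y \<inter> elts x = {}"
    and pairing: "\<exists>z. elts z = {x, y}"
    and union: "\<exists>u. elts u = (\<Union>y\<in>elts x. elts y)"
    and power_set: "\<exists>p. elts p = {w. elts w \<subseteq> elts x}"
    and infinity: "\<exists>I. (\<exists>e\<in>elts I. elts e = {}) \<and>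
      (\<forall>n\<in>elts I. \<exists>m\<in>elts I. elts m = insert n (elts n))"
    and separation: "\<exists>y. elts y = {z \<in> elts x. sat E p (s(0 := z))}"
    and replacement: "(\<forall>x\<in>elts a. \<forall>y y'.
        sat E p (s(0 := x, 1 := y)) \<and> sat E p (s(0 := x, 1 := y')) \<longrightarrow> y = y') \<Longrightarrow>
      \<exists>b. elts b = {y. \<exists>x\<in>elts a. sat E p (s(0 := x, 1 := y))}"

end

theory Submission
  imports Defs
begin

text \<open>
  The proof uses clopen ultrafilters and is arranged so that the choices it makes are all covered
  by \<open>CMC\<close>.  Embed the zero-dimensional \<open>T\<^sub>1\<close>-space \<open>X\<close> by evaluation into the power of \<open>\<omega>\<close>
  indexed by all continuous \<open>f : X \<rightarrow> \<omega>\<close>.  A point of the closure of the image determines an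
  ultrafilter \<open>U\<close> of clopen sets in which every countable clopen partition of \<open>X\<close> has a member
  (\<open>limit_point_ultrafilter\<close>), and the image is closed as soon as each such \<open>U\<close> has a point in its
  intersection (\<open>N_compactI\<close>).

  To find this point, call a class large if it includes the intersection of a sequence from \<open>U\<close>.
  The completeness of \<open>U\<close> says that large classes are non-empty (\<open>big_nonempty\<close>).  \<open>CMC\<close> makes them
  closed under countable intersections (\<open>big_countable\<close>): from non-empty finite sets of witnessing
  sequences one obtains a single sequence by intersecting all that is available at finite stages.
  So the complements of the \<open>S\<^sub>n\<close> cannot all be large, and there is \<open>n\<close> such that every large class
  meets \<open>S\<^sub>n\<close>.  Since \<open>S\<^sub>n\<close> is \<open>c\<^sub>\<delta>\<close>-embedded, \<open>U\<close> decides the clopen subsets of \<open>S\<^sub>n\<close> up to large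
  classes (\<open>big_clopen_dichotomy\<close>); by closure under countable intersections it then decides the value
  of every continuous map \<open>S\<^sub>n \<rightarrow> \<omega>\<close>.  For the coordinates of an embedding of \<open>S\<^sub>n\<close> as a closed subspace
  of a power of \<open>\<omega>\<close> these values form a point of that subspace, and the corresponding point of \<open>S\<^sub>n\<close>
  lies in every member of \<open>U\<close> (\<open>sigma_ultrafilter_point\<close>).

  All of this takes place in an arbitrary model of ZF, so each set and each function that is used
  has to be an element of the model, and each induction along its \<open>\<omega>\<close> has to be applied to a
  definable predicate.  A calculus of definable predicates and terms reduces these obligations to
  backward chaining with the rules \<open>definable_rules\<close>.
\<close>

section \<open>Predicates definable over a membership relation\<close>

primrec rename_fm :: "(nat \<Rightarrow> nat) \<Rightarrow> fm \<Rightarrow> fm" where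
  "rename_fm r (Mem i j) = Mem (r i) (r j)"
| "rename_fm r (Eq i j) = Eq (r i) (r j)"
| "rename_fm r (Neg p) = Neg (rename_fm r p)"
| "rename_fm r (Conj p q) = Conj (rename_fm r p) (rename_fm r q)"
| "rename_fm r (All i p) = All (r i) (rename_fm r p)"

text \<open>
  Injectivity of the renaming is what excludes the capture of variables.
\<close>

lemma sat_rename:
  assumes "inj r"
  shows "sat E (rename_fm r p) t \<longleftrightarrow> sat E p (t \<circ> r)"
proof (induction p arbitrary: t)
  case (All i p)
  have "(t(r i := a)) \<circ> r = (t \<circ> r)(i := a)" for a
    using assms by (auto simp: fun_eq_iff inj_eq)
  then show ?case by (simp only: rename_fm.simps sat.simps All.IH)
qed auto

text \<open>
  The arguments of a predicate sit at the even variables and its parameters at the odd ones, so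
  that there is always room for more of both.
\<close>

definition interleave :: "(nat \<Rightarrow> 'v) \<Rightarrow> (nat \<Rightarrow> 'v) \<Rightarrow> nat \<Rightarrow> 'v" where
  "interleave s e n = (if even n then s (n div 2) else e (n div 2))"

lemma interleave_simps [simp]:
  "interleave s e 0 = s 0" "interleave s e (2 * i) = s i" "interleave s e (Suc (2 * i)) = e i"
  by (auto simp: interleave_def)

lemma sat_rename_interleave:
  assumes "inj r" "\<And>i. t (r (2 * i)) = s i" "\<And>i. t (r (Suc (2 * i))) = e i"
  shows "sat E (rename_fm r p) t \<longleftrightarrow> sat E p (interleave s e)"
proof -
  have "t \<circ> r = interleave s e"
  proof
    fix n
    show "(t \<circ> r) n = interleave s e n"
      by (cases "even n") (auto elim!: evenE oddE simp: assms(2,3))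
  qed
  then show ?thesis by (simp add: sat_rename[OF assms(1)])
qed

context membership begin

text \<open>
  An environment \<open>s\<close> is read as a stack: a quantifier pushes the bound variable at position 0 and
  shifts the rest by one.  In this form every closure property below is a rule whose conclusion is
  a higher-order pattern, and definability of a concrete predicate is found by backward chaining.
\<close>

definition definable :: "((nat \<Rightarrow> 'v) \<Rightarrow> bool) \<Rightarrow> bool" where
  "definable P \<longleftrightarrow> (\<exists>p e. \<forall>s. P s \<longleftrightarrow> sat E p (interleave s e))"

text \<open>
  A term is treated through its graph, the value being at position 0.
\<close>

definition definable_term :: "((nat \<Rightarrow> 'v) \<Rightarrow> 'v) \<Rightarrow> bool" where
  "definable_term t \<longleftrightarrow> definable (\<lambda>s. s 0 = t (\<lambda>i. s (Suc i)))"

lemma definable_not: "definable P \<Longrightarrow> definable (\<lambda>s. \<not> P s)"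
  unfolding definable_def by (metis sat.simps(3))

text \<open>
  The parameters of the two formulas are interleaved, the first formula using the even-numbered
  and the second the odd-numbered ones.
\<close>

lemma definable_conj:
  assumes "definable P" "definable Q"
  shows "definable (\<lambda>s. P s \<and> Q s)"
proof -
  obtain p1 e1 p2 e2 where 1: "\<And>s. P s \<longleftrightarrow> sat E p1 (interleave s e1)"
    and 2: "\<And>s. Q s \<longleftrightarrow> sat E p2 (interleave s e2)"
    using assms unfolding definable_def by metis
  define r1 r2 :: "nat \<Rightarrow> nat" where
    "r1 n = (if even n then n else 2 * n - 1)" and "r2 n = (if even n then n else 2 * n + 1)" for n
  have "inj r1"
    by (rule inj_on_inverseI[where g = "\<lambda>n. if even n then n else (n + 1) div 2"])
      (auto simp: r1_def elim!: oddE)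
  moreover have "inj r2"
    by (rule inj_on_inverseI[where g = "\<lambda>n. if even n then n else (n - 1) div 2"])
      (auto simp: r2_def)
  ultimately have "inj r1" "inj r2" .
  note r = sat_rename_interleave[OF this(1)] sat_rename_interleave[OF this(2)]
  have e: "\<And>i. interleave s (interleave e1 e2) (Suc (4 * i)) = e1 i" "\<And>i. interleave s (interleave e1 e2) (Suc (Suc (Suc (4 * i)))) = e2 i" for s
    by (auto simp: interleave_def)
  have "sat E (rename_fm r1 p1) (interleave s (interleave e1 e2)) \<longleftrightarrow> P s"
       "sat E (rename_fm r2 p2) (interleave s (interleave e1 e2)) \<longleftrightarrow> Q s" for s
    using e by (auto simp: 1 2 r1_def r2_def intro!: r)
  then show ?thesis unfolding definable_def
    by (intro exI[of _ "Conj (rename_fm r1 p1) (rename_fm r2 p2)"] exI[of _ "interleave e1 e2"]) simp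
qed

text \<open>
  The stack position 0 of \<open>Q\<close> is renamed to the variable 1, the first parameter place, and is
  quantified there; the parameters move up by one place to free it.
\<close>

lemma definable_all:
  assumes "definable (\<lambda>s. Q (s 0) (\<lambda>i. s (Suc i)))"
  shows "definable (\<lambda>s. \<forall>a. Q a s)"
proof -
  obtain p e where 1: "\<And>s. Q (s 0) (\<lambda>i. s (Suc i)) \<longleftrightarrow> sat E p (interleave s e)"
    using assms unfolding definable_def by metis
  define r :: "nat \<Rightarrow> nat" where
    "r n = (if n = 0 then 1 else if even n then n - 2 else n + 2)" for n
  have "inj r"
    by (rule inj_on_inverseI[where g = "\<lambda>n. if n = 1 then 0 else if even n then n + 2 else n - 2"])
      (auto simp: r_def elim!: evenE, arith?)
  note r = sat_rename_interleave[OF this]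
  have *: "sat E (rename_fm r p) ((interleave s (case_nat d e))(1 := a)) \<longleftrightarrow> Q a s" for s d a
  proof -
    have "sat E (rename_fm r p) ((interleave s (case_nat d e))(1 := a)) \<longleftrightarrow> sat E p (interleave (case_nat a s) e)"
    proof (rule r)
      show "((interleave s (case_nat d e))(1 := a)) (r (2 * i)) = case_nat a s i" for i
        by (cases i) (auto simp: r_def interleave_def)
      show "((interleave s (case_nat d e))(1 := a)) (r (Suc (2 * i))) = e i" for i
        by (auto simp: r_def interleave_def)
    qed
    then show ?thesis using 1[of "case_nat a s"] by simp
  qed
  show ?thesis unfolding definable_def
    \<comment> \<open>The place freed for the bound variable may hold any value.\<close>
    by (intro exI[of _ "All 1 (rename_fm r p)"] exI[of _ "case_nat undefined e"]) (simp add: *[simplified])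
qed

lemma definable_weaken:
  assumes "definable P" "inj r"
  shows "definable (\<lambda>s. P (\<lambda>i. s (r i)))"
proof -
  obtain p e where 1: "\<And>s. P s \<longleftrightarrow> sat E p (interleave s e)"
    using assms(1) unfolding definable_def by metis
  define r' :: "nat \<Rightarrow> nat" where "r' n = (if even n then 2 * r (n div 2) else n)" for n
  have "inj r'"
    by (rule inj_on_inverseI[where g = "\<lambda>n. if even n then 2 * inv r (n div 2) else n"])
      (auto simp: r'_def inv_f_f[OF assms(2)])
  note r = sat_rename_interleave[OF this]
  have "sat E (rename_fm r' p) (interleave s e) \<longleftrightarrow> P (\<lambda>i. s (r i))" for s
    unfolding 1 by (rule r) (auto simp: r'_def)
  then show ?thesis unfolding definable_def by metis
qed

lemma definable_var_mem: "definable (\<lambda>s. s i \<in> elts (s j))"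
  unfolding definable_def elts_def by (rule exI[of _ "Mem (2 * i) (2 * j)"]) simp

lemma definable_var_eq: "definable (\<lambda>s. s i = s j)"
  unfolding definable_def by (rule exI[of _ "Eq (2 * i) (2 * j)"]) simp

lemma definable_term_const: "definable_term (\<lambda>s. c)"
  unfolding definable_term_def definable_def by (rule exI[of _ "Eq 0 1"]) (rule exI[of _ "\<lambda>i. c"], simp add: interleave_def)

lemma definable_term_var: "definable_term (\<lambda>s. s i)"
  unfolding definable_term_def by (rule definable_var_eq)

lemma definable_term_weaken:
  "definable_term t \<Longrightarrow> definable_term (\<lambda>s. t (\<lambda>i. s (Suc i)))"
  unfolding definable_term_def
  by (drule definable_weaken[where r = "case_nat 0 (\<lambda>i. Suc (Suc i))"])
    (auto simp: inj_def split: nat.splits)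

lemma definable_prop: "definable (\<lambda>s. c)"
  by (cases c) (auto simp: definable_def intro: exI[of _ "Eq 0 0"] exI[of _ "Neg (Eq 0 0)"])

lemma definable_disj:
  "definable P \<Longrightarrow> definable Q \<Longrightarrow> definable (\<lambda>s. P s \<or> Q s)"
  using definable_not[OF definable_conj[OF definable_not definable_not], of P Q] by simp

lemma definable_imp:
  "definable P \<Longrightarrow> definable Q \<Longrightarrow>
   definable (\<lambda>s. P s \<longrightarrow> Q s)"
  using definable_not[OF definable_conj[OF _ definable_not], of P Q] by simp

lemma definable_iff:
  "definable P \<Longrightarrow> definable Q \<Longrightarrow>
   definable (\<lambda>s. P s \<longleftrightarrow> Q s)"
  using definable_conj[OF definable_imp definable_imp, of P Q Q P] by (simp add: iff_conv_conj_imp)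

lemma definable_ex:
  "definable (\<lambda>s. Q (s 0) (\<lambda>i. s (Suc i))) \<Longrightarrow>
   definable (\<lambda>s. \<exists>a. Q a s)"
  using definable_not[OF definable_all[of "\<lambda>a s. \<not> Q a s"]] definable_not[of "\<lambda>s. Q (s 0) (\<lambda>i. s (Suc i))"] by simp

text \<open>
  \<open>P (a)\<close> means that some \<open>x\<close> is equal to \<open>a\<close> and satisfies \<open>P\<close>.
\<close>

lemma definable_subst:
  assumes "definable P" "definable_term a"
  shows "definable (\<lambda>s. P (case_nat (a s) s))"
proof -
  have "definable (\<lambda>s. \<exists>x. x = a s \<and> P (case_nat x s))"
  proof (rule definable_ex, rule definable_conj)
    show "definable (\<lambda>s. s 0 = a (\<lambda>i. s (Suc i)))" using assms(2) unfolding definable_term_def .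
    have "case_nat (s 0) (\<lambda>i. s (Suc i)) = s" for s :: "nat \<Rightarrow> 'v"
      by (auto simp: fun_eq_iff split: nat.splits)
    then show "definable (\<lambda>s. P (case_nat (s 0) (\<lambda>i. s (Suc i))))" using assms(1) by simp
  qed
  then show ?thesis by simp
qed

lemma definable_subst1:
  "definable (\<lambda>s. R (s 0)) \<Longrightarrow> definable_term a \<Longrightarrow> definable (\<lambda>s. R (a s))"
  using definable_subst[of "\<lambda>s. R (s 0)" a] by simp

lemma definable_subst2:
  "definable (\<lambda>s. R (s 0) (s 1)) \<Longrightarrow> definable_term a \<Longrightarrow> definable_term b \<Longrightarrow> definable (\<lambda>s. R (a s) (b s))"
  using definable_subst[OF definable_subst[OF _ definable_term_weaken], of "\<lambda>s. R (s 0) (s 1)" a b] by simp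

lemma definable_subst3:
  assumes "definable (\<lambda>s. R (s 0) (s 1) (s 2))" "definable_term a" "definable_term b" "definable_term c"
  shows "definable (\<lambda>s. R (a s) (b s) (c s))"
proof -
  have "definable (\<lambda>s. R (a (\<lambda>i. s (Suc (Suc i)))) (s 0) (s 1))"
    using definable_subst[OF assms(1) definable_term_weaken[OF definable_term_weaken[OF assms(2)]]] by simp
  from definable_subst[OF this definable_term_weaken[OF assms(3)]]
  have "definable (\<lambda>s. R (a (\<lambda>i. s (Suc i))) (b (\<lambda>i. s (Suc i))) (s 0))" by simp
  from definable_subst[OF this assms(4)] show ?thesis by simp
qed

lemma definable_mem:
  "definable_term a \<Longrightarrow> definable_term b \<Longrightarrow>
   definable (\<lambda>s. a s \<in> elts (b s))"
  by (rule definable_subst2[of "\<lambda>x y. x \<in> elts y"]) (rule definable_var_mem)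

lemma definable_eq:
  "definable_term a \<Longrightarrow> definable_term b \<Longrightarrow>
   definable (\<lambda>s. a s = b s)"
  by (rule definable_subst2[of "\<lambda>x y. x = y"]) (rule definable_var_eq)

lemma definable_ball:
  "definable_term a \<Longrightarrow> definable (\<lambda>s. Q (s 0) (\<lambda>i. s (Suc i))) \<Longrightarrow> definable (\<lambda>s. \<forall>x\<in>elts (a s). Q x s)"
  unfolding Ball_def by (intro definable_all definable_imp definable_mem definable_term_var definable_term_weaken)

lemma definable_bex:
  "definable_term a \<Longrightarrow> definable (\<lambda>s. Q (s 0) (\<lambda>i. s (Suc i))) \<Longrightarrow> definable (\<lambda>s. \<exists>x\<in>elts (a s). Q x s)"
  unfolding Bex_def by (intro definable_ex definable_conj definable_mem definable_term_var definable_term_weaken)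

lemma definable_subset:
  "definable_term a \<Longrightarrow> definable_term b \<Longrightarrow>
   definable (\<lambda>s. elts (a s) \<subseteq> elts (b s))"
  unfolding subset_iff by (intro definable_all definable_imp definable_mem definable_term_var definable_term_weaken)

lemma definable_ex1:
  "definable (\<lambda>s. Q (s 0) (\<lambda>i. s (Suc i))) \<Longrightarrow> definable (\<lambda>s. Q (s 0) (\<lambda>i. s (Suc (Suc i)))) \<Longrightarrow> definable (\<lambda>s. \<exists>!a. Q a s)"
  unfolding Ex1_def by (intro definable_all definable_ex definable_conj definable_imp definable_eq definable_term_var)

end

section \<open>Sets and functions of a model\<close>

context membership begin

text \<open>
  Classes are HOL sets of elements of the model; only some of them are extensions of sets.
\<close>

definition is_set :: "'v set \<Rightarrow> bool" where
  "is_set B \<longleftrightarrow> (\<exists>x. elts x = B)"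

text \<open>
  The value \<open>app f x\<close> is a definite description and hence unspecified where \<open>f\<close> is not single-valued,
  so no formula can describe it there.  The union of all values of \<open>f\<close> at \<open>x\<close> is definable without
  any condition and agrees with \<open>app f x\<close> on the domain of a function.
\<close>

definition ap :: "'v \<Rightarrow> 'v \<Rightarrow> 'v" where
  "ap f x = set_of {z. \<exists>y. opair x y \<in> elts f \<and> z \<in> elts y}"

definition powerset :: "'v \<Rightarrow> 'v" where
  "powerset x = set_of {w. elts w \<subseteq> elts x}"

definition product :: "'v \<Rightarrow> 'v \<Rightarrow> 'v" where
  "product a b = set_of {p. \<exists>x\<in>elts a. \<exists>y\<in>elts b. p = opair x y}"

end

context ZF begin

lemma set_of_elts [simp]: "set_of (elts x) = x"
  unfolding set_of_def by (rule the_equality) (auto dest: extensionality)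

lemma elts_set_of: "is_set B \<Longrightarrow> elts (set_of B) = B"
  unfolding is_set_def by auto

lemma eq_set_of: "is_set B \<Longrightarrow> x = set_of B \<longleftrightarrow> elts x = B"
  using elts_set_of extensionality by blast

lemma is_set_elts [simp]: "is_set (elts x)"
  unfolding is_set_def by auto

text \<open>
  The separation scheme, freed from formulas and assignments.
\<close>

lemma sepI:
  assumes "definable (\<lambda>s. Q (s 0))"
  shows "is_set {z \<in> elts x. Q z}"
proof -
  obtain p e where 1: "\<And>s. Q (s 0) \<longleftrightarrow> sat E p (interleave s e)"
    using assms unfolding definable_def by metis
  have "Q z \<longleftrightarrow> sat E p ((interleave (\<lambda>i. x) e)(0 := z))" for z
  proof -
    have "interleave (case_nat z (\<lambda>i. x)) e = (interleave (\<lambda>i. x) e)(0 := z)"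
      by (auto simp: interleave_def fun_eq_iff split: nat.splits)
    then show ?thesis using 1[of "case_nat z (\<lambda>i. x)"] by simp
  qed
  then show ?thesis using separation[of x p "interleave (\<lambda>i. x) e"] unfolding is_set_def by simp
qed

lemma sepI_sub:
  assumes "definable (\<lambda>s. Q (s 0))" "\<And>z. Q z \<Longrightarrow> z \<in> elts x"
  shows "is_set {z. Q z}"
proof -
  have "{z. Q z} = {z \<in> elts x. Q z}" using assms(2) by auto
  then show ?thesis using sepI[OF assms(1)] by simp
qed

lemma is_set_pair [simp]: "is_set {x, y}" and is_set_single [simp]: "is_set {x}"
  using pairing[of x y] pairing[of x x] unfolding is_set_def by auto

lemma is_set_empty [simp]: "is_set {}"
  using sepI[OF definable_prop[of False], of undefined] by simp

lemma elts_pair [simp]: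
  "elts (set_of {x, y}) = {x, y}" and elts_single [simp]: "elts (set_of {x}) = {x}"
  and elts_empty [simp]: "elts empty = {}"
  unfolding empty_def by (simp_all add: elts_set_of)

lemma is_set_Union: "is_set (\<Union>y\<in>elts x. elts y)"
  using union[of x] unfolding is_set_def .

lemma elts_powerset [simp]: "elts (powerset x) = {w. elts w \<subseteq> elts x}"
  unfolding powerset_def by (rule elts_set_of) (use power_set[of x] in \<open>simp add: is_set_def\<close>)

lemma is_set_Un: "is_set (elts x \<union> elts y)"
  using is_set_Union[of "set_of {x, y}"] by simp

lemma is_set_insert: "is_set (insert a (elts y))"
  using is_set_Un[of "set_of {a}" y] by simp

lemma opair_eq [simp]: "opair a b = opair c d \<longleftrightarrow> a = c \<and> b = d"
proof -
  have "elts (opair a b) = {set_of {a}, set_of {a, b}}" for a b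
    unfolding opair_def by simp
  note e = this
  have S: "set_of {a, b} = set_of {c, d} \<longleftrightarrow> {a, b} = {c, d}" for a b c d
    using elts_pair[of a b] elts_pair[of c d] by metis
  show ?thesis
  proof
    assume "opair a b = opair c d"
    then have "{set_of {a}, set_of {a, b}} = {set_of {c}, set_of {c, d}}" using e by metis
    then show "a = c \<and> b = d"
      using S[of a a c c] S[of a a c d] S[of a b c c] S[of a b c d]
      by (auto simp: doubleton_eq_iff)
  qed simp
qed

lemma definable_term_set_of:
  assumes "\<And>s. is_set {z. Q z s}" "definable (\<lambda>s. Q (s 0) (\<lambda>i. s (Suc i)))"
  shows "definable_term (\<lambda>s. set_of {z. Q z s})"
proof -
  have "definable (\<lambda>s. \<forall>z. z \<in> elts (s 0) \<longleftrightarrow> Q z (\<lambda>i. s (Suc i)))"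
  proof (intro definable_all definable_iff definable_mem definable_term_var)
    show "definable (\<lambda>s. Q (s 0) (\<lambda>i. s (Suc (Suc i))))"
      using definable_weaken[OF assms(2), of "case_nat 0 (\<lambda>i. Suc (Suc i))"]
      by (auto simp: inj_def split: nat.splits)
  qed
  moreover have "(\<forall>z. z \<in> elts x \<longleftrightarrow> Q z s) \<longleftrightarrow> x = set_of {z. Q z s}" for x s
    using eq_set_of[OF assms(1)[of s]] by auto
  ultimately show ?thesis unfolding definable_term_def by simp
qed

lemma definable_term_subst2:
  "definable_term (\<lambda>s. f (s 0) (s 1)) \<Longrightarrow> definable_term a \<Longrightarrow> definable_term b \<Longrightarrow>
   definable_term (\<lambda>s. f (a s) (b s))"
  unfolding definable_term_def
  using definable_subst3[of "\<lambda>x y z. x = f y z" "\<lambda>s. s 0" "\<lambda>s. a (\<lambda>i. s (Suc i))" "\<lambda>s. b (\<lambda>i. s (Suc i))"]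
  by (simp add: definable_term_var definable_term_weaken[unfolded definable_term_def] definable_term_def numeral_2_eq_2)

lemma definable_term_pair:
  "definable_term a \<Longrightarrow> definable_term b \<Longrightarrow>
   definable_term (\<lambda>s. set_of {a s, b s})"
proof (rule definable_term_subst2[of "\<lambda>x y. set_of {x, y}"])
  have *: "{z. z = x \<or> z = y} = {x, y}" for x y :: 'v by auto
  have "definable_term (\<lambda>s. set_of {z. z = s 0 \<or> z = s 1})"
    by (rule definable_term_set_of) (auto simp: * intro!: definable_disj definable_eq definable_term_var)
  then show "definable_term (\<lambda>s. set_of {s 0, s 1})" by (simp add: *)
qed

lemma definable_term_opair:
  "definable_term a \<Longrightarrow> definable_term b \<Longrightarrow>
   definable_term (\<lambda>s. opair (a s) (b s))"
  unfolding opair_def using definable_term_pair[OF definable_term_pair[of a a] definable_term_pair[of a b]] by simp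

lemma is_set_ap: "is_set {z. \<exists>y. opair x y \<in> elts f \<and> z \<in> elts y}"
proof -
  let ?U = "\<lambda>x. set_of (\<Union>y\<in>elts x. elts y)"
  have U: "elts (?U x) = (\<Union>y\<in>elts x. elts y)" for x
    by (rule elts_set_of) (rule is_set_Union)
  show ?thesis
  proof (rule sepI_sub[of _ "?U (?U (?U f))"])
    show "definable (\<lambda>s. \<exists>y. opair x y \<in> elts f \<and> s 0 \<in> elts y)"
      by (intro definable_ex definable_conj definable_mem definable_term_opair definable_term_const definable_term_var)
    fix z assume "\<exists>y. opair x y \<in> elts f \<and> z \<in> elts y"
    then obtain y where y: "opair x y \<in> elts f" "z \<in> elts y" by blast
    have U_I: "c \<in> elts (?U a)" if "c \<in> elts b" "b \<in> elts a" for a b c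
      unfolding U using that by auto
    have "set_of {x, y} \<in> elts (opair x y)" "y \<in> elts (set_of {x, y})"
      unfolding opair_def by simp_all
    then show "z \<in> elts (?U (?U (?U f)))"
      using U_I y by meson
  qed
qed

lemma definable_term_ap:
  "definable_term a \<Longrightarrow> definable_term b \<Longrightarrow>
   definable_term (\<lambda>s. ap (a s) (b s))"
proof (rule definable_term_subst2[of ap])
  show "definable_term (\<lambda>s. ap (s 0) (s 1))" unfolding ap_def
    by (intro definable_term_set_of is_set_ap definable_ex definable_conj definable_mem definable_term_opair definable_term_var)
qed

lemma definable_is_function:
  "definable_term a \<Longrightarrow> definable_term b \<Longrightarrow>
   definable (\<lambda>s. is_function (a s) (b s))"
proof (rule definable_subst2[of is_function])
  show "definable (\<lambda>s. is_function (s 0) (s 1))" unfolding is_function_def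
    by (intro definable_conj definable_ball definable_bex definable_ex definable_eq definable_ex1 definable_mem definable_term_opair definable_term_var)
qed

lemma app_ap: "is_function f A \<Longrightarrow> x \<in> elts A \<Longrightarrow> app f x = ap f x"
proof -
  assume "is_function f A" "x \<in> elts A"
  then obtain y where y: "opair x y \<in> elts f" "\<And>z. opair x z \<in> elts f \<Longrightarrow> z = y"
    unfolding is_function_def by blast
  have "{z. \<exists>y. opair x y \<in> elts f \<and> z \<in> elts y} = elts y" using y by blast
  then have "ap f x = y" unfolding ap_def by simp
  moreover have "app f x = y" unfolding app_def by (rule the_equality) (fact y)+
  ultimately show ?thesis by simp
qed

lemma maps_ap:
  "maps f A B \<longleftrightarrow> is_function f A \<and> (\<forall>x\<in>elts A. ap f x \<in> elts B)"
  unfolding maps_def using app_ap by auto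

lemma definable_maps:
  "definable_term a \<Longrightarrow> definable_term b \<Longrightarrow> definable_term c \<Longrightarrow>
   definable (\<lambda>s. maps (a s) (b s) (c s))"
proof (rule definable_subst3[of maps])
  show "definable (\<lambda>s. maps (s 0) (s 1) (s 2))" unfolding maps_ap
    by (intro definable_conj definable_ball definable_is_function definable_mem definable_term_ap definable_term_var)
qed

lemmas definable_rules =
  definable_prop definable_not definable_conj definable_disj definable_imp definable_iff
  definable_ball definable_bex definable_all definable_ex definable_subset definable_mem
  definable_eq definable_is_function definable_maps
  definable_term_const definable_term_var definable_term_opair definable_term_ap

lemma is_function_ap:
  assumes "is_function f A" "x \<in> elts A"
  shows "opair x y \<in> elts f \<longleftrightarrow> y = ap f x"
proof -
  have "\<exists>!y. opair x y \<in> elts f" using assms unfolding is_function_def by blast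
  from theI'[OF this] this show ?thesis unfolding app_ap[OF assms, symmetric] app_def by blast
qed

lemma function_ext:
  assumes "is_function f A" "is_function g A" "\<And>x. x \<in> elts A \<Longrightarrow> ap f x = ap g x"
  shows "f = g"
proof (rule extensionality)
  have "elts f \<subseteq> elts g"
    if fg: "is_function f A" "is_function g A" "\<And>x. x \<in> elts A \<Longrightarrow> ap f x = ap g x" for f g
  proof
    fix p assume p: "p \<in> elts f"
    then obtain x y where "x \<in> elts A" "p = opair x y" using fg(1) unfolding is_function_def by blast
    then show "p \<in> elts g" using p is_function_ap[OF fg(1)] is_function_ap[OF fg(2)] fg(3) by metis
  qed
  from this[OF assms] this[OF assms(2,1)] assms(3) show "elts f = elts g" by auto
qed

lemma elts_product [simp]:
  "elts (product a b) = {p. \<exists>x\<in>elts a. \<exists>y\<in>elts b. p = opair x y}"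
  unfolding product_def
proof (rule elts_set_of, rule sepI_sub)
  show "definable (\<lambda>s. \<exists>x\<in>elts a. \<exists>y\<in>elts b. s 0 = opair x y)" by (intro definable_rules)
  fix p assume "\<exists>x\<in>elts a. \<exists>y\<in>elts b. p = opair x y"
  then show "p \<in> elts (powerset (powerset (set_of (elts a \<union> elts b))))"
    by (auto simp: elts_set_of is_set_Un opair_def)
qed

text \<open>
  The function is cut out of \<open>product A B\<close> by separation.  Uniqueness of the value stands in for
  the choice of one.
\<close>

lemma function_ex:
  assumes "definable (\<lambda>s. R (s 0) (s 1))"
    and "\<And>x. x \<in> elts A \<Longrightarrow> \<exists>y\<in>elts B. R x y"
    and "\<And>x y z. x \<in> elts A \<Longrightarrow> y \<in> elts B \<Longrightarrow> z \<in> elts B \<Longrightarrow> R x y \<Longrightarrow> R x z \<Longrightarrow> y = z"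
  obtains f where "maps f A B" "\<And>x. x \<in> elts A \<Longrightarrow> R x (ap f x)"
proof -
  let ?F = "{p. \<exists>x\<in>elts A. \<exists>y\<in>elts B. p = opair x y \<and> R x y}"
  have "is_set ?F"
  proof (rule sepI_sub[of _ "product A B"])
    show "definable (\<lambda>s. \<exists>x\<in>elts A. \<exists>y\<in>elts B. s 0 = opair x y \<and> R x y)"
      by (intro definable_rules definable_subst2[OF assms(1)])
  qed auto
  then obtain f where f: "elts f = ?F" unfolding is_set_def by blast
  have 1: "is_function f A"
    unfolding is_function_def
  proof (intro conjI ballI)
    fix x assume x: "x \<in> elts A"
    then obtain y where "y \<in> elts B" "R x y" using assms(2) by blast
    then show "\<exists>!y. opair x y \<in> elts f" using x assms(3)[OF x] unfolding f by auto
  qed (auto simp: f)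
  have "ap f x \<in> elts B \<and> R x (ap f x)" if "x \<in> elts A" for x
    using is_function_ap[OF 1 that, of "ap f x"] f by auto
  then show thesis using 1 that unfolding maps_ap by blast
qed

lemma elts_power_space [simp]: "elts (power_space B A) = {f. maps f A B}"
  unfolding power_space_def
proof (rule elts_set_of, rule sepI_sub)
  show "definable (\<lambda>s. maps (s 0) A B)" by (intro definable_rules)
  fix f assume f: "maps f A B"
  have "p \<in> elts (product A B)" if p: "p \<in> elts f" for p
  proof -
    obtain x y where xy: "x \<in> elts A" "p = opair x y"
      using f p unfolding maps_def is_function_def by blast
    then have "y = ap f x" using f p is_function_ap unfolding maps_def by blast
    then show ?thesis using f xy unfolding maps_ap by auto
  qed
  then show "f \<in> elts (powerset (product A B))"
    by auto
qed

lemma definable_term_insert: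
  "definable_term a \<Longrightarrow> definable_term b \<Longrightarrow>
   definable_term (\<lambda>s. set_of (insert (a s) (elts (b s))))"
proof (rule definable_term_subst2[of "\<lambda>x y. set_of (insert x (elts y))"])
  have "{z. z = x \<or> z \<in> elts y} = insert x (elts y)" for x y by auto
  moreover have "definable_term (\<lambda>s. set_of {z. z = s 0 \<or> z \<in> elts (s 1)})"
    by (rule definable_term_set_of) (auto simp: calculation is_set_insert intro!: definable_rules)
  ultimately show "definable_term (\<lambda>s. set_of (insert (s 0) (elts (s 1))))" by simp
qed

end

section \<open>Natural numbers and finite sets\<close>

context membership begin

abbreviation succ :: "'v \<Rightarrow> 'v" where
  "succ n \<equiv> set_of (insert n (elts n))"

text \<open>
  Unlike \<open>set_of B \<in> elts V\<close>, this says by itself that \<open>B\<close> is the extension of a set.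
\<close>

definition belongs :: "'v set \<Rightarrow> 'v \<Rightarrow> bool" where
  "belongs B V \<longleftrightarrow> (\<exists>A\<in>elts V. elts A = B)"

end

context ZF begin

lemma elts_insert [simp]: "elts (set_of (insert a (elts y))) = insert a (elts y)"
  by (rule elts_set_of) (rule is_set_insert)

lemma is_set_Int [simp]: "is_set (elts x \<inter> elts y)"
  using sepI[of "\<lambda>z. z \<in> elts y" x, OF definable_mem[OF definable_term_var definable_term_const]] by (simp add: Int_def)

lemma is_set_Diff [simp]: "is_set (elts x - elts y)"
  using sepI[of "\<lambda>z. z \<notin> elts y" x, OF definable_not[OF definable_mem[OF definable_term_var definable_term_const]]]
  by (simp add: set_diff_eq)

lemma belongs_set_of:
  "is_set B \<Longrightarrow> belongs B V \<longleftrightarrow> set_of B \<in> elts V"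
  unfolding belongs_def is_set_def by (metis set_of_elts)

lemma belongs_elts [simp]: "belongs (elts A) V \<longleftrightarrow> A \<in> elts V"
  by (simp add: belongs_set_of)

lemma definable_belongs:
  assumes "definable (\<lambda>s. Q (s 0) (\<lambda>i. s (Suc (Suc i))))"
  shows "definable (\<lambda>s. belongs {x \<in> elts X. Q x s} V)"
proof -
  have "belongs {x \<in> elts X. Q x s} V \<longleftrightarrow> (\<exists>A\<in>elts V. \<forall>x. x \<in> elts A \<longleftrightarrow> x \<in> elts X \<and> Q x s)" for s
    unfolding belongs_def by blast
  moreover have "definable (\<lambda>s. \<exists>A\<in>elts V. \<forall>x. x \<in> elts A \<longleftrightarrow> x \<in> elts X \<and> Q x s)"
    by (intro definable_rules assms)
  ultimately show ?thesis by simp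
qed

lemma mem_irrefl: "x \<notin> elts x"
  using foundation[of "set_of {x}"] by auto

lemma elts_omega: "elts omega = {n. \<forall>I. is_inductive I \<longrightarrow> n \<in> elts I}"
  unfolding omega_def
proof (rule elts_set_of)
  obtain I where I: "\<exists>e\<in>elts I. elts e = {}" "\<forall>n\<in>elts I. \<exists>m\<in>elts I. elts m = insert n (elts n)"
    using infinity by blast
  have "succ n \<in> elts I" if "n \<in> elts I" for n
    using I(2) that by (metis set_of_elts)
  moreover have "empty \<in> elts I" using I(1) unfolding empty_def by (metis set_of_elts)
  ultimately have "is_inductive I" unfolding is_inductive_def by blast
  then show "is_set {n. \<forall>I. is_inductive I \<longrightarrow> n \<in> elts I}"
    by (intro sepI_sub[of _ I]) (auto simp: is_inductive_def intro!: definable_rules definable_term_insert)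
qed

lemma omega_0 [simp]:
  "empty \<in> elts omega" and omega_succ: "n \<in> elts omega \<Longrightarrow>
   succ n \<in> elts omega"
  unfolding elts_omega is_inductive_def by auto

lemma omega_induct:
  assumes "n \<in> elts omega" "definable (\<lambda>s. P (s 0))" "P empty"
    and "\<And>n. n \<in> elts omega \<Longrightarrow> P n \<Longrightarrow> P (succ n)"
  shows "P n"
proof -
  obtain I where I: "elts I = {n \<in> elts omega. P n}"
    using sepI[OF assms(2), of omega] unfolding is_set_def by blast
  have "is_inductive I" unfolding is_inductive_def I using assms omega_succ by auto
  then have "n \<in> elts I" using assms(1) unfolding elts_omega by blast
  then show ?thesis unfolding I by simp
qed

lemma omega_subset: "n \<in> elts omega \<Longrightarrow> elts n \<subseteq> elts omega"
  by (erule omega_induct) (auto intro!: definable_rules)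

lemma omega_succ_mem:
  "n \<in> elts omega \<Longrightarrow> \<forall>m\<in>elts n. succ m \<in> elts n \<or> succ m = n"
  by (erule omega_induct) (auto intro!: definable_rules definable_term_insert)

lemma omega_0_mem: "n \<in> elts omega \<Longrightarrow> n = empty \<or> empty \<in> elts n"
  by (erule omega_induct) (auto intro!: definable_rules)

lemma omega_linear:
  "n \<in> elts omega \<Longrightarrow>
   \<forall>m\<in>elts omega. m \<in> elts n \<or> m = n \<or> n \<in> elts m"
proof (erule omega_induct)
  show "\<forall>m\<in>elts omega. m \<in> elts empty \<or> m = empty \<or> empty \<in> elts m" using omega_0_mem by auto
  fix n assume "\<forall>m\<in>elts omega. m \<in> elts n \<or> m = n \<or> n \<in> elts m"
  then show "\<forall>m\<in>elts omega. m \<in> elts (succ n) \<or> m = succ n \<or> succ n \<in> elts m"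
    using omega_succ_mem by auto
qed (intro definable_rules)

lemma omega_upper:
  assumes "n \<in> elts omega" "k \<in> elts omega"
  obtains m where "m \<in> elts omega" "n \<in> elts m" "k \<in> elts m"
proof (cases "k \<in> elts (succ n)")
  case True then show thesis using that[of "succ n"] omega_succ assms by simp
next
  case False then show thesis using that[of "succ k"] omega_succ assms omega_linear[of n] by auto
qed

lemma fin_iff:
  "fin A \<longleftrightarrow> (\<exists>n\<in>elts omega. \<exists>f. maps f n A \<and>
     (\<forall>x\<in>elts n. \<forall>y\<in>elts n. ap f x = ap f y \<longrightarrow> x = y) \<and> (\<forall>y\<in>elts A. \<exists>x\<in>elts n. ap f x = y))"
  (is "?L = ?R")
proof -
  have "injective f n \<longleftrightarrow> (\<forall>x\<in>elts n. \<forall>y\<in>elts n. ap f x = ap f y \<longrightarrow> x = y)"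
    "surjective f n A \<longleftrightarrow> (\<forall>y\<in>elts A. \<exists>x\<in>elts n. ap f x = y)" if "maps f n A" for f n
    using that app_ap unfolding injective_def surjective_def maps_def by auto
  then show ?thesis unfolding fin_def by blast
qed

lemma definable_fin: "definable_term a \<Longrightarrow> definable (\<lambda>s. fin (a s))"
proof (rule definable_subst1[of fin])
  show "definable (\<lambda>s. fin (s 0))" unfolding fin_iff by (intro definable_rules)
qed

lemma fin_omega:
  assumes "n \<in> elts omega" shows "fin n"
proof -
  obtain f where "maps f n n" "\<And>x. x \<in> elts n \<Longrightarrow> x = ap f x"
    by (rule function_ex[of "\<lambda>x y. x = y" n n]) (auto intro!: definable_rules)
  then show ?thesis unfolding fin_iff using assms by (intro bexI[of _ n] exI[of _ f]) auto
qed

lemma fin_empty: "fin empty"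
  by (simp add: fin_omega)

lemma fin_insert:
  assumes "fin K" shows "fin (set_of (insert a (elts K)))"
proof (cases "a \<in> elts K")
  case True then show ?thesis using assms by (simp add: insert_absorb)
next
  case False
  obtain n f where nf: "n \<in> elts omega" "maps f n K"
    "\<forall>x\<in>elts n. \<forall>y\<in>elts n. ap f x = ap f y \<longrightarrow> x = y" "\<forall>y\<in>elts K. \<exists>x\<in>elts n. ap f x = y"
    using assms unfolding fin_iff by blast
  have fK: "ap f i \<in> elts K" if "i \<in> elts n" for i using nf(2) that unfolding maps_ap by blast
  obtain g where g: "maps g (succ n) (set_of (insert a (elts K)))"
    "\<And>x. x \<in> elts (succ n) \<Longrightarrow> (x = n \<and> ap g x = a) \<or> (x \<noteq> n \<and> ap g x = ap f x)"
    by (rule function_ex[of "\<lambda>x y. (x = n \<and> y = a) \<or> (x \<noteq> n \<and> y = ap f x)" "succ n" "set_of (insert a (elts K))"])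
      (auto intro!: definable_rules simp: mem_irrefl fK)
  have gn: "ap g n = a" and gf: "\<And>x. x \<in> elts n \<Longrightarrow> ap g x = ap f x"
    using g(2) mem_irrefl by fastforce+
  show ?thesis unfolding fin_iff
  proof (intro bexI[of _ "succ n"] exI[of _ g] conjI)
    show "\<forall>x\<in>elts (succ n). \<forall>y\<in>elts (succ n). ap g x = ap g y \<longrightarrow> x = y"
      using nf(3) gn gf False fK by (metis elts_insert insert_iff)
    show "\<forall>y\<in>elts (set_of (insert a (elts K))). \<exists>x\<in>elts (succ n). ap g x = y"
      using nf(4) gn gf by (metis elts_insert insert_iff)
  qed (use g(1) nf(1) omega_succ in auto)
qed

lemma fin_single: "fin (set_of {a})"
  using fin_insert[OF fin_empty] by simp

text \<open>
  A finite set of the model need not be finite in HOL, because its \<open>\<omega>\<close> may be nonstandard.  Hence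
  finite intersections are formed by an induction inside the model, along an enumeration of \<open>K\<close>,
  and this is why \<open>R\<close> has to be definable.
\<close>

lemma finite_Int:
  assumes V: "X \<in> elts V" "\<And>A B. A \<in> elts V \<Longrightarrow> B \<in> elts V \<Longrightarrow> belongs (elts A \<inter> elts B) V"
    and R: "definable (\<lambda>s. R (s 0) (s 1))" and "fin K"
    and K: "\<And>j. j \<in> elts K \<Longrightarrow> belongs {x \<in> elts X. R j x} V"
  shows "belongs {x \<in> elts X. \<forall>j\<in>elts K. R j x} V"
proof -
  obtain n f where nf: "n \<in> elts omega" "maps f n K" "\<forall>y\<in>elts K. \<exists>x\<in>elts n. ap f x = y"
    using \<open>fin K\<close> unfolding fin_iff by blast
  have fK: "ap f i \<in> elts K" if "i \<in> elts n" for i using nf(2) that unfolding maps_ap by blast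
  have "elts n \<subseteq> elts n \<longrightarrow> belongs {x \<in> elts X. \<forall>i\<in>elts n. R (ap f i) x} V"
    using nf(1)
  proof (rule omega_induct[where P = "\<lambda>m. elts m \<subseteq> elts n \<longrightarrow> belongs {x \<in> elts X. \<forall>i\<in>elts m. R (ap f i) x} V"])
    show "definable (\<lambda>s. elts (s 0) \<subseteq> elts n \<longrightarrow> belongs {x \<in> elts X. \<forall>i\<in>elts (s 0). R (ap f i) x} V)"
      by (intro definable_rules definable_belongs definable_subst2[OF R])
    show "elts empty \<subseteq> elts n \<longrightarrow> belongs {x \<in> elts X. \<forall>i\<in>elts empty. R (ap f i) x} V"
      using V(1) by simp
    fix m
    assume IH: "elts m \<subseteq> elts n \<longrightarrow> belongs {x \<in> elts X. \<forall>i\<in>elts m. R (ap f i) x} V"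
    show "elts (succ m) \<subseteq> elts n \<longrightarrow> belongs {x \<in> elts X. \<forall>i\<in>elts (succ m). R (ap f i) x} V"
    proof
      assume m: "elts (succ m) \<subseteq> elts n"
      then obtain A where A: "A \<in> elts V" "elts A = {x \<in> elts X. \<forall>i\<in>elts m. R (ap f i) x}"
        using IH unfolding belongs_def by auto
      obtain B where B: "B \<in> elts V" "elts B = {x \<in> elts X. R (ap f m) x}"
        using K[OF fK, of m] m unfolding belongs_def by auto
      have "elts A \<inter> elts B = {x \<in> elts X. \<forall>i\<in>elts (succ m). R (ap f i) x}" using A B by auto
      then show "belongs {x \<in> elts X. \<forall>i\<in>elts (succ m). R (ap f i) x} V"
        using V(2)[OF A(1) B(1)] by simp
    qed
  qed
  moreover have "(\<forall>i\<in>elts n. R (ap f i) x) \<longleftrightarrow> (\<forall>j\<in>elts K. R j x)" for x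
    using fK nf(3) by metis
  ultimately show ?thesis by simp
qed

lemma CMC_ap:
  assumes CMC "is_function A omega" "\<And>n. n \<in> elts omega \<Longrightarrow> elts (ap A n) \<noteq> {}"
  obtains F where "is_function F omega" "\<And>n. n \<in> elts omega \<Longrightarrow>
    elts (ap F n) \<subseteq> elts (ap A n) \<and> elts (ap F n) \<noteq> {} \<and> fin (ap F n)"
  using assms app_ap unfolding CMC_def by (metis (no_types, lifting))

end

section \<open>Clopen ultrafilters and countable intersections\<close>

context membership begin

text \<open>
  Open fibres make \<open>f\<close> a continuous map into the discrete space \<open>\<omega>\<close>.
\<close>

definition continuous_omega :: "'v \<Rightarrow> 'v \<Rightarrow> 'v \<Rightarrow> bool" where
  "continuous_omega X T f \<longleftrightarrow> maps f X omega \<and> (\<forall>n\<in>elts omega. belongs {x \<in> elts X. ap f x = n} T)"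

text \<open>
  The last clause is the form of countable completeness that is available without choice: every
  partition of \<open>X\<close> into a sequence of clopen sets has a member in \<open>U\<close>.
\<close>

definition sigma_ultrafilter :: "'v \<Rightarrow> 'v \<Rightarrow> 'v \<Rightarrow> bool" where
  "sigma_ultrafilter X T U \<longleftrightarrow>
     (\<forall>C\<in>elts U. clopen X T C) \<and> empty \<notin> elts U \<and> X \<in> elts U \<and>
     (\<forall>C\<in>elts U. \<forall>D\<in>elts U. belongs (elts C \<inter> elts D) U) \<and>
     (\<forall>C. clopen X T C \<longrightarrow> C \<in> elts U \<or> set_of (elts X - elts C) \<in> elts U) \<and>
     (\<forall>f. continuous_omega X T f \<longrightarrow> (\<exists>n\<in>elts omega. belongs {x \<in> elts X. ap f x = n} U))"

text \<open>
  Under \<open>CMC\<close> these classes form the filter generated by the countable intersections of members of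
  \<open>U\<close>, the large classes of the comments below.  The countable families are given as sequences,
  so that finitely many of them can be intersected term by term.
\<close>

definition big :: "'v \<Rightarrow> 'v \<Rightarrow> ('v \<Rightarrow> bool) \<Rightarrow> bool" where
  "big X U Q \<longleftrightarrow> (\<exists>c. maps c omega U \<and> (\<forall>x\<in>elts X. (\<forall>k\<in>elts omega. x \<in> elts (ap c k)) \<longrightarrow> Q x))"

end

context ZF begin

lemma clopen_iff:
  "clopen X T C \<longleftrightarrow> C \<in> elts T \<and> elts C \<subseteq> elts X \<and> belongs (elts X - elts C) T"
  unfolding clopen_def closed_in_def by (auto simp: belongs_set_of)

lemma definable_big:
  assumes "definable (\<lambda>s. Q (s 0) (\<lambda>i. s (Suc (Suc i))))"
  shows "definable (\<lambda>s. big X U (\<lambda>x. Q x s))"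
  unfolding big_def by (intro definable_rules assms)

lemma topology:
  assumes "topological_space X T"
  shows open_space: "X \<in> elts T" and open_empty: "empty \<in> elts T"
    and open_Int: "U \<in> elts T \<Longrightarrow> V \<in> elts T \<Longrightarrow> belongs (elts U \<inter> elts V) T"
  using assms unfolding topological_space_def by (auto simp: belongs_set_of)

text \<open>
  The class is the union of all open sets that it includes, so no neighbourhoods are chosen.
\<close>

lemma open_local:
  assumes "topological_space X T" "is_set G"
    and "\<And>x. x \<in> G \<Longrightarrow> \<exists>U\<in>elts T. x \<in> elts U \<and> elts U \<subseteq> G"
  shows "belongs G T"
proof -
  obtain g where g: "elts g = G" using assms(2) unfolding is_set_def by blast
  have "is_set {U \<in> elts T. elts U \<subseteq> elts g}" by (rule sepI) (intro definable_rules)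
  then obtain F where F: "elts F = {U \<in> elts T. elts U \<subseteq> elts g}" unfolding is_set_def by blast
  have "(\<Union>U\<in>elts F. elts U) = elts g" using assms(3) unfolding F g by auto
  moreover have "set_of (\<Union>U\<in>elts F. elts U) \<in> elts T"
    using assms(1) F unfolding topological_space_def by auto
  ultimately show ?thesis using g by (metis belongs_elts set_of_elts)
qed

context
  fixes X T U
  assumes top: "topological_space X T" and U: "sigma_ultrafilter X T U"
begin

lemma U_clopen: "C \<in> elts U \<Longrightarrow> clopen X T C"
  and U_space: "X \<in> elts U"
  and U_empty: "empty \<notin> elts U"
  and U_Int: "C \<in> elts U \<Longrightarrow> D \<in> elts U \<Longrightarrow> belongs (elts C \<inter> elts D) U"
  and U_ultra: "clopen X T C \<Longrightarrow> C \<in> elts U \<or> set_of (elts X - elts C) \<in> elts U"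
  and U_fibre: "continuous_omega X T f \<Longrightarrow> \<exists>n\<in>elts omega. belongs {x \<in> elts X. ap f x = n} U"
  using U unfolding sigma_ultrafilter_def by auto

lemma U_subset:
  "C \<in> elts U \<Longrightarrow> elts C \<subseteq> elts X" and U_open: "C \<in> elts U \<Longrightarrow>
   C \<in> elts T"
  using U_clopen unfolding clopen_iff by auto

lemma big_mono:
  "big X U Q \<Longrightarrow> (\<And>x. x \<in> elts X \<Longrightarrow> Q x \<Longrightarrow> R x) \<Longrightarrow>
   big X U R"
  unfolding big_def by blast

lemma big_mem:
  assumes "A \<in> elts U" shows "big X U (\<lambda>x. x \<in> elts A)"
proof -
  obtain c where "maps c omega U" "\<And>k. k \<in> elts omega \<Longrightarrow> ap c k = A"
    by (rule function_ex[of "\<lambda>k y. y = A" omega U]) (auto intro!: definable_rules assms)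
  then show ?thesis unfolding big_def using omega_0 by blast
qed

text \<open>
  A sequence of members of \<open>U\<close> with empty intersection would split \<open>X\<close> into clopen pieces according
  to the first term that omits a point.  Countable completeness puts one of the pieces into \<open>U\<close>, yet
  the piece of index \<open>m\<close> is disjoint from the \<open>m\<close>-th term, which is also in \<open>U\<close>.
\<close>

lemma big_nonempty:
  assumes "big X U Q" shows "\<exists>x\<in>elts X. Q x"
proof (rule ccontr)
  assume "\<not> ?thesis"
  then obtain c where c: "maps c omega U"
    and none: "\<And>x. x \<in> elts X \<Longrightarrow> \<exists>k\<in>elts omega. x \<notin> elts (ap c k)"
    using assms unfolding big_def by blast
  have cU: "ap c k \<in> elts U" if "k \<in> elts omega" for k using c that unfolding maps_ap by blast
  obtain f where f: "maps f X omega"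
    "\<And>x. x \<in> elts X \<Longrightarrow> (\<forall>i\<in>elts (ap f x). x \<in> elts (ap c i)) \<and> x \<notin> elts (ap c (ap f x))"
  proof (rule function_ex[of "\<lambda>x m. (\<forall>i\<in>elts m. x \<in> elts (ap c i)) \<and> x \<notin> elts (ap c m)" X omega])
    show "definable (\<lambda>s. (\<forall>i\<in>elts (s 1). s 0 \<in> elts (ap c i)) \<and> s 0 \<notin> elts (ap c (s 1)))"
      by (intro definable_rules)
  next
    fix x assume x: "x \<in> elts X"
    have "is_set {k \<in> elts omega. x \<notin> elts (ap c k)}" by (rule sepI) (intro definable_rules)
    then obtain K where K: "elts K = {k \<in> elts omega. x \<notin> elts (ap c k)}" unfolding is_set_def by blast
    then have "elts K \<noteq> {}" using none[OF x] by auto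
    from foundation[OF this] obtain m where m: "m \<in> elts K" "elts m \<inter> elts K = {}" by blast
    show "\<exists>m\<in>elts omega. (\<forall>i\<in>elts m. x \<in> elts (ap c i)) \<and> x \<notin> elts (ap c m)"
      using m omega_subset[of m] unfolding K by blast
  next
    fix x m n
    assume "m \<in> elts omega" "n \<in> elts omega"
      "(\<forall>i\<in>elts m. x \<in> elts (ap c i)) \<and> x \<notin> elts (ap c m)"
      "(\<forall>i\<in>elts n. x \<in> elts (ap c i)) \<and> x \<notin> elts (ap c n)"
    then show "m = n" using omega_linear[of m] by blast
  qed (use that in blast)
  \<comment> \<open>Finitely many clopen conditions describe the fibre over \<open>m\<close>.\<close>
  have least: "ap f x = m \<longleftrightarrow> (\<forall>i\<in>elts m. x \<in> elts (ap c i)) \<and> x \<notin> elts (ap c m)"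
    if "x \<in> elts X" "m \<in> elts omega" for x m
  proof -
    have "ap f x \<in> elts omega" using f(1) that(1) unfolding maps_ap by blast
    then show ?thesis using f(2)[OF that(1)] omega_linear[OF that(2)] by blast
  qed
  have init: "belongs {x \<in> elts X. \<forall>i\<in>elts m. x \<in> elts (ap c i)} U" if m: "m \<in> elts omega" for m
  proof (rule finite_Int)
    show "belongs {x \<in> elts X. x \<in> elts (ap c i)} U" if "i \<in> elts m" for i
    proof -
      have "ap c i \<in> elts U" using cU omega_subset[OF m] that by blast
      moreover have "{x \<in> elts X. x \<in> elts (ap c i)} = elts (ap c i)"
        using U_subset[OF calculation] by auto
      ultimately show ?thesis by simp
    qed
  qed (auto intro!: U_space U_Int definable_rules fin_omega m)
  have "continuous_omega X T f" unfolding continuous_omega_def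
  proof (intro conjI ballI f(1))
    fix m assume m: "m \<in> elts omega"
    obtain A where A: "A \<in> elts U" "elts A = {x \<in> elts X. \<forall>i\<in>elts m. x \<in> elts (ap c i)}"
      using init[OF m] unfolding belongs_def by blast
    obtain B where B: "B \<in> elts T" "elts B = elts X - elts (ap c m)"
      using U_clopen[OF cU[OF m]] unfolding clopen_iff belongs_def by blast
    have "{x \<in> elts X. ap f x = m} = elts A \<inter> elts B" using least m A B by auto
    then show "belongs {x \<in> elts X. ap f x = m} T"
      using open_Int[OF top U_open[OF A(1)] B(1)] by simp
  qed
  from U_fibre[OF this] obtain m where m: "m \<in> elts omega" "belongs {x \<in> elts X. ap f x = m} U" by blast
  then obtain A where A: "A \<in> elts U" "elts A = {x \<in> elts X. ap f x = m}" unfolding belongs_def by blast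
  have "elts A \<inter> elts (ap c m) = elts empty" using A(2) least m(1) by auto
  then have "belongs (elts empty) U" using U_Int[OF A(1) cU[OF m(1)]] by simp
  then show False using U_empty belongs_elts by blast
qed

text \<open>
  One would like to choose for each \<open>n\<close> a sequence that witnesses \<open>big (R n)\<close>.  \<open>CMC\<close> only gives a
  non-empty finite set \<open>F n\<close> of such sequences, but this is enough: the sets
  \<open>D m\<close>, the intersection of all \<open>c k\<close> with \<open>n, k < m\<close> and \<open>c \<in> F n\<close>, are finite intersections of members
  of \<open>U\<close>, and a point that lies in all of them lies in all terms of some witness for each \<open>n\<close>.
\<close>

lemma big_countable:
  assumes CMC and R: "definable (\<lambda>s. R (s 0) (s 1))"
    and bigR: "\<And>n. n \<in> elts omega \<Longrightarrow> big X U (R n)"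
  shows "big X U (\<lambda>x. \<forall>n\<in>elts omega. R n x)"
proof -
  define seq where "seq n c \<longleftrightarrow> maps c omega U \<and>
    (\<forall>x\<in>elts X. (\<forall>k\<in>elts omega. x \<in> elts (ap c k)) \<longrightarrow> R n x)" for n c
  have definable_seq: "definable_term a \<Longrightarrow> definable_term b \<Longrightarrow> definable (\<lambda>s. seq (a s) (b s))" for a b
    by (rule definable_subst2[of seq]) (auto simp: seq_def[abs_def] intro!: definable_rules definable_subst2[OF R])
  have ex: "is_set {c. seq n c}" for n
  proof (rule sepI_sub[of _ "power_space U omega"])
    show "definable (\<lambda>s. seq n (s 0))" by (intro definable_seq definable_term_const definable_term_var)
  qed (simp add: seq_def)
  obtain A where A: "maps A omega (powerset (power_space U omega))"
    "\<And>n. n \<in> elts omega \<Longrightarrow> \<forall>c. c \<in> elts (ap A n) \<longleftrightarrow> seq n c"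
  proof (rule function_ex[of "\<lambda>n Y. \<forall>c. c \<in> elts Y \<longleftrightarrow> seq n c" omega "powerset (power_space U omega)"])
    show "definable (\<lambda>s. \<forall>c. c \<in> elts (s 1) \<longleftrightarrow> seq (s 0) c)" by (intro definable_rules definable_seq)
    show "\<exists>Y\<in>elts (powerset (power_space U omega)). \<forall>c. c \<in> elts Y \<longleftrightarrow> seq n c" for n
    proof -
      have "{c. seq n c} \<subseteq> elts (power_space U omega)" by (auto simp: seq_def)
      then show ?thesis by (intro bexI[of _ "set_of {c. seq n c}"]) (simp_all add: elts_set_of[OF ex] subset_iff)
    qed
  qed (auto intro: extensionality that)
  have "is_function A omega" using A(1) unfolding maps_def by blast
  moreover have "elts (ap A n) \<noteq> {}" if "n \<in> elts omega" for n
    using bigR[OF that] A(2)[OF that] unfolding big_def seq_def by blast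
  ultimately obtain F where F: "is_function F omega" "\<And>n. n \<in> elts omega \<Longrightarrow>
    elts (ap F n) \<subseteq> elts (ap A n) \<and> elts (ap F n) \<noteq> {} \<and> fin (ap F n)"
    using CMC_ap[OF \<open>CMC\<close>] by blast
  have seqF: "seq n c" if "n \<in> elts omega" "c \<in> elts (ap F n)" for n c
    using F(2)[OF that(1)] A(2)[OF that(1)] that(2) by blast
  let ?Q = "\<lambda>m x. \<forall>n\<in>elts m. \<forall>k\<in>elts m. \<forall>c\<in>elts (ap F n). x \<in> elts (ap c k)"
  note I = finite_Int[OF U_space U_Int]
  have Q: "belongs {x \<in> elts X. ?Q m x} U" if m: "m \<in> elts omega" for m
  proof (rule I[of "\<lambda>n x. \<forall>k\<in>elts m. \<forall>c\<in>elts (ap F n). x \<in> elts (ap c k)"])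
    fix n assume "n \<in> elts m"
    then have n: "n \<in> elts omega" using omega_subset[OF m] by blast
    show "belongs {x \<in> elts X. \<forall>k\<in>elts m. \<forall>c\<in>elts (ap F n). x \<in> elts (ap c k)} U"
    proof (rule I[of "\<lambda>k x. \<forall>c\<in>elts (ap F n). x \<in> elts (ap c k)"])
      fix k assume "k \<in> elts m"
      then have k: "k \<in> elts omega" using omega_subset[OF m] by blast
      show "belongs {x \<in> elts X. \<forall>c\<in>elts (ap F n). x \<in> elts (ap c k)} U"
      proof (rule I[of "\<lambda>c x. x \<in> elts (ap c k)"])
        fix c assume "c \<in> elts (ap F n)"
        then have "ap c k \<in> elts U" using seqF[OF n] k unfolding seq_def maps_ap by blast
        moreover have "{x \<in> elts X. x \<in> elts (ap c k)} = elts (ap c k)"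
          using U_subset[OF calculation] by auto
        ultimately show "belongs {x \<in> elts X. x \<in> elts (ap c k)} U" by simp
      qed (use F(2)[OF n] in \<open>auto intro!: definable_rules\<close>)
    qed (auto intro!: definable_rules fin_omega m)
  qed (auto intro!: definable_rules fin_omega m)
  obtain D where D: "maps D omega U"
    "\<And>m. m \<in> elts omega \<Longrightarrow> \<forall>x. x \<in> elts (ap D m) \<longleftrightarrow> x \<in> elts X \<and> ?Q m x"
  proof (rule function_ex[of "\<lambda>m Y. \<forall>x. x \<in> elts Y \<longleftrightarrow> x \<in> elts X \<and> ?Q m x" omega U])
    show "definable (\<lambda>s. \<forall>x. x \<in> elts (s 1) \<longleftrightarrow> x \<in> elts X \<and> ?Q (s 0) x)" by (intro definable_rules)
    show "\<exists>Y\<in>elts U. \<forall>x. x \<in> elts Y \<longleftrightarrow> x \<in> elts X \<and> ?Q m x" if "m \<in> elts omega" for m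
      using Q[OF that] unfolding belongs_def set_eq_iff mem_Collect_eq .
  qed (auto intro: extensionality that)
  have "R n x" if x: "x \<in> elts X" "\<forall>m\<in>elts omega. x \<in> elts (ap D m)" and n: "n \<in> elts omega" for x n
  proof -
    obtain c where c: "c \<in> elts (ap F n)" using F(2)[OF n] by blast
    have "x \<in> elts (ap c k)" if k: "k \<in> elts omega" for k
    proof -
      obtain m where "m \<in> elts omega" "n \<in> elts m" "k \<in> elts m" using omega_upper[OF n k] .
      then show ?thesis using x(2) D(2) c by blast
    qed
    then show ?thesis using seqF[OF n c] x(1) unfolding seq_def by blast
  qed
  then show ?thesis unfolding big_def using D(1) by blast
qed

text \<open>
  An enumeration of \<open>K\<close>, continued by trivial conditions, turns this into a countable intersection.
\<close>

lemma big_fin: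
  assumes CMC and R: "definable (\<lambda>s. R (s 0) (s 1))" and "fin K"
    and bigR: "\<And>j. j \<in> elts K \<Longrightarrow> big X U (R j)"
  shows "big X U (\<lambda>x. \<forall>j\<in>elts K. R j x)"
proof -
  obtain n f where nf: "n \<in> elts omega" "maps f n K" "\<forall>y\<in>elts K. \<exists>x\<in>elts n. ap f x = y"
    using \<open>fin K\<close> unfolding fin_iff by blast
  have "big X U (\<lambda>x. \<forall>i\<in>elts omega. i \<in> elts n \<longrightarrow> R (ap f i) x)"
  proof (rule big_countable[OF \<open>CMC\<close>])
    show "definable (\<lambda>s. s 0 \<in> elts n \<longrightarrow> R (ap f (s 0)) (s 1))" by (intro definable_rules definable_subst2[OF R])
    fix i assume "i \<in> elts omega"
    show "big X U (\<lambda>x. i \<in> elts n \<longrightarrow> R (ap f i) x)"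
    proof (cases "i \<in> elts n")
      case True
      then have "ap f i \<in> elts K" using nf(2) unfolding maps_ap by blast
      from bigR[OF this] show ?thesis by (rule big_mono) simp
    qed (use big_mono[OF big_mem[OF U_space]] in auto)
  qed
  then show ?thesis by (rule big_mono) (metis nf(3) omega_subset[OF nf(1)] subsetD)
qed

lemma big_conj:
  assumes CMC "definable (\<lambda>s. P (s 0))" "definable (\<lambda>s. Q (s 0))" "big X U P" "big X U Q"
  shows "big X U (\<lambda>x. P x \<and> Q x)"
proof -
  have "big X U (\<lambda>x. \<forall>i\<in>elts omega. (i = empty \<and> P x) \<or> (i \<noteq> empty \<and> Q x))"
  proof (rule big_countable[OF \<open>CMC\<close>])
    show "definable (\<lambda>s. (s 0 = empty \<and> P (s 1)) \<or> (s 0 \<noteq> empty \<and> Q (s 1)))"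
      by (intro definable_rules definable_subst1[OF assms(2)] definable_subst1[OF assms(3)])
    show "big X U (\<lambda>x. (i = empty \<and> P x) \<or> (i \<noteq> empty \<and> Q x))" for i
      using assms(4,5) by (cases "i = empty") auto
  qed
  moreover have "succ empty \<noteq> empty" by (metis elts_insert elts_empty insert_not_empty)
  ultimately show ?thesis using omega_succ[OF omega_0] omega_0 by (blast intro: big_mono)
qed

end

end

section \<open>Subspaces and powers of the discrete space of natural numbers\<close>

context ZF begin

lemma elts_discrete [simp]: "elts (discrete Y) = {U. elts U \<subseteq> elts Y}"
  unfolding discrete_def powerset_def[symmetric] by simp

lemma elts_subspace:
  "elts (subspace T S) = {V. \<exists>U\<in>elts T. elts V = elts U \<inter> elts S}"
  unfolding subspace_def
proof (rule elts_set_of, rule sepI_sub)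
  have "definable (\<lambda>s. \<exists>U\<in>elts T. \<forall>x. x \<in> elts (s 0) \<longleftrightarrow> x \<in> elts U \<and> x \<in> elts S)"
    by (intro definable_rules)
  then show "definable (\<lambda>s. \<exists>U\<in>elts T. elts (s 0) = elts U \<inter> elts S)"
    by (simp only: set_eq_iff Int_iff)
  show "V \<in> elts (powerset S)" if "\<exists>U\<in>elts T. elts V = elts U \<inter> elts S" for V
    using that by auto
qed

lemma continuous_iff:
  "continuous f X T Y T' \<longleftrightarrow> maps f X Y \<and> (\<forall>V\<in>elts T'. belongs {x \<in> elts X. ap f x \<in> elts V} T)"
proof -
  have "set_of {x \<in> elts X. app f x \<in> elts V} \<in> elts T \<longleftrightarrow> belongs {x \<in> elts X. ap f x \<in> elts V} T"
    if "maps f X Y" for V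
  proof -
    have "is_set {x \<in> elts X. ap f x \<in> elts V}" by (rule sepI) (intro definable_rules)
    moreover have "{x \<in> elts X. app f x \<in> elts V} = {x \<in> elts X. ap f x \<in> elts V}"
      using that app_ap unfolding maps_def by auto
    ultimately show ?thesis by (simp add: belongs_set_of)
  qed
  then show ?thesis unfolding continuous_def by blast
qed

lemma elts_box:
  assumes "elts K \<subseteq> elts J" "is_function u K"
  shows "elts (box Y J K u) = {g. maps g J Y \<and> (\<forall>j\<in>elts K. ap g j \<in> elts (ap u j))}"
proof -
  have "app g j = ap g j" if "maps g J Y" "j \<in> elts K" for g j
    using that assms(1) app_ap unfolding maps_def by blast
  then have "{g \<in> elts (power_space Y J). \<forall>j\<in>elts K. app g j \<in> elts (app u j)} =
      {g. maps g J Y \<and> (\<forall>j\<in>elts K. ap g j \<in> elts (ap u j))}"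
    using app_ap[OF assms(2)] by auto
  moreover have "is_set {g. maps g J Y \<and> (\<forall>j\<in>elts K. ap g j \<in> elts (ap u j))}"
    by (rule sepI_sub[of _ "power_space Y J"]) (auto intro!: definable_rules)
  ultimately show ?thesis unfolding box_def by (simp add: elts_set_of)
qed

text \<open>
  The functions that agree with \<open>g\<close> on a finite set of coordinates form a neighbourhood base of \<open>g\<close> in
  the power \<open>\<omega>\<^sup>J\<close> of the discrete space \<open>\<omega>\<close>.
\<close>

definition agree_nbhd :: "'v \<Rightarrow> 'v \<Rightarrow> 'v \<Rightarrow> bool" where
  "agree_nbhd J W g \<longleftrightarrow> (\<exists>K. fin K \<and> elts K \<subseteq> elts J \<and>
     (\<forall>g'. maps g' J omega \<and> (\<forall>j\<in>elts K. ap g' j = ap g j) \<longrightarrow> g' \<in> elts W))"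

text \<open>
  A box with discrete factors includes with each point \<open>g\<close> the functions that agree with \<open>g\<close> on the
  coordinates of the box.  Conversely, \<open>W\<close> is the union of all boxes of singletons inside \<open>W\<close>.
\<close>

lemma elts_power_topology:
  "elts (power_topology omega (discrete omega) J) =
     {W. elts W \<subseteq> elts (power_space omega J) \<and> (\<forall>g\<in>elts W. agree_nbhd J W g)}"
proof -
  let ?box = "{box omega J K u | K u. elts K \<subseteq> elts J \<and> fin K \<and> maps u K (discrete omega)}"
  have "(\<exists>\<U>. elts \<U> \<subseteq> ?box \<and> elts W = (\<Union>B\<in>elts \<U>. elts B)) \<longleftrightarrow>
    elts W \<subseteq> elts (power_space omega J) \<and> (\<forall>g\<in>elts W. agree_nbhd J W g)" (is "?L \<longleftrightarrow> ?R") for W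
  proof
    assume ?L
    then obtain F where F: "elts F \<subseteq> ?box" "elts W = (\<Union>B\<in>elts F. elts B)" by blast
    have "g \<in> elts (power_space omega J) \<and> agree_nbhd J W g" if "g \<in> elts W" for g
    proof -
      obtain B where B: "B \<in> elts F" "g \<in> elts B" using \<open>g \<in> elts W\<close> F(2) by blast
      then obtain K u where Ku: "B = box omega J K u" "elts K \<subseteq> elts J" "fin K" "maps u K (discrete omega)"
        using F(1) by blast
      have *: "elts B = {g. maps g J omega \<and> (\<forall>j\<in>elts K. ap g j \<in> elts (ap u j))}"
        using elts_box Ku unfolding maps_def by simp
      have "maps g J omega" using * B(2) by simp
      moreover have "agree_nbhd J W g"
        unfolding agree_nbhd_def
      proof (intro exI[of _ K] conjI allI impI Ku(2,3))
        fix g' assume "maps g' J omega \<and> (\<forall>j\<in>elts K. ap g' j = ap g j)"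
        then have "g' \<in> elts B" using B(2) unfolding * by simp
        then show "g' \<in> elts W" using F(2) B(1) by blast
      qed
      ultimately show ?thesis by simp
    qed
    then show ?R by blast
  next
    assume R: ?R
    \<comment> \<open>A box is described by a point \<open>g\<close> instead of a family of singletons, to ease definability.\<close>
    let ?P = "\<lambda>B. elts B \<subseteq> elts W \<and> (\<exists>K. fin K \<and> elts K \<subseteq> elts J \<and> (\<exists>g. maps g J omega \<and>
      (\<forall>g'. g' \<in> elts B \<longleftrightarrow> maps g' J omega \<and> (\<forall>j\<in>elts K. ap g' j = ap g j))))"
    have "is_set {B. ?P B}"
      by (rule sepI_sub[of _ "powerset W"]) (auto intro!: definable_rules definable_fin)
    then obtain F where F: "elts F = {B. ?P B}" unfolding is_set_def by blast
    have "elts F \<subseteq> ?box"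
    proof
      fix B assume "B \<in> elts F"
      then obtain K g where K: "fin K" "elts K \<subseteq> elts J" "maps g J omega"
        "\<And>g'. g' \<in> elts B \<longleftrightarrow> maps g' J omega \<and> (\<forall>j\<in>elts K. ap g' j = ap g j)"
        unfolding F by blast
      have gK: "ap g j \<in> elts omega" if "j \<in> elts K" for j
        using K(2,3) that unfolding maps_ap by blast
      obtain u where u: "maps u K (discrete omega)"
        "\<And>j. j \<in> elts K \<Longrightarrow> \<forall>x. x \<in> elts (ap u j) \<longleftrightarrow> x = ap g j"
      proof (rule function_ex[of "\<lambda>j y. \<forall>x. x \<in> elts y \<longleftrightarrow> x = ap g j" K "discrete omega"])
        show "\<exists>y\<in>elts (discrete omega). \<forall>x. x \<in> elts y \<longleftrightarrow> x = ap g j" if "j \<in> elts K" for j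
          using gK[OF that] by (intro bexI[of _ "set_of {ap g j}"]) auto
      qed (auto intro!: definable_rules intro: extensionality that)
      then have "is_function u K" unfolding maps_def by blast
      from elts_box[OF K(2) this] have "elts (box omega J K u) = elts B"
        using u(2) K(4) by auto
      then have "B = box omega J K u" using extensionality by blast
      then show "B \<in> ?box" using K u(1) by blast
    qed
    moreover have "elts W = (\<Union>B\<in>elts F. elts B)"
    proof (rule subset_antisym)
      show "elts W \<subseteq> (\<Union>B\<in>elts F. elts B)"
      proof
        fix g assume g: "g \<in> elts W"
        then obtain K where K: "fin K" "elts K \<subseteq> elts J"
          "\<And>g'. maps g' J omega \<Longrightarrow> (\<forall>j\<in>elts K. ap g' j = ap g j) \<Longrightarrow> g' \<in> elts W"
          using R unfolding agree_nbhd_def by blast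
        have mg: "maps g J omega" using R g by auto
        let ?B = "{g'. maps g' J omega \<and> (\<forall>j\<in>elts K. ap g' j = ap g j)}"
        have "is_set ?B"
          by (rule sepI_sub[of _ "power_space omega J"]) (auto intro!: definable_rules)
        then obtain B where B: "elts B = ?B" unfolding is_set_def by blast
        have "?P B" using K mg B by blast
        then show "g \<in> (\<Union>B\<in>elts F. elts B)" using B mg unfolding F by blast
      qed
    qed (auto simp: F)
    ultimately show ?L by blast
  qed
  note eq = this
  have "is_set {W. elts W \<subseteq> elts (power_space omega J) \<and> (\<forall>g\<in>elts W. agree_nbhd J W g)}"
    by (rule sepI_sub[of _ "powerset (power_space omega J)"])
      (unfold agree_nbhd_def, intro definable_rules definable_fin, simp)
  then show ?thesis unfolding power_topology_def eq by (rule elts_set_of)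
qed

lemma coordinate_open:
  assumes "j \<in> elts J" "definable (\<lambda>s. P (s 0))"
  shows "belongs {g \<in> elts (power_space omega J). P (ap g j)} (power_topology omega (discrete omega) J)"
proof -
  have "is_set {g \<in> elts (power_space omega J). P (ap g j)}"
    by (rule sepI) (intro definable_rules definable_subst1[OF assms(2)])
  then obtain W where W: "elts W = {g \<in> elts (power_space omega J). P (ap g j)}"
    unfolding is_set_def by blast
  have "agree_nbhd J W g" if "g \<in> elts W" for g
    unfolding agree_nbhd_def
    by (rule exI[of _ "set_of {j}"]) (use that W assms(1) fin_single in auto)
  then have "W \<in> elts (power_topology omega (discrete omega) J)"
    unfolding elts_power_topology using W by auto
  then show ?thesis using W by (metis belongs_elts)
qed

section \<open>Points of ultrafilters on N-compact subspaces\<close>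
context
  fixes X T U S
  assumes top: "topological_space X T" and U: "sigma_ultrafilter X T U" and CMC
    and S: "\<not> big X U (\<lambda>x. x \<notin> elts S)"
begin

text \<open>
  Although \<open>A\<close> need not extend to a clopen subset of \<open>X\<close>, it is the trace of an intersection of
  countably many clopen sets.  If all of these are in \<open>U\<close>, then \<open>A\<close> includes the trace of a countable
  intersection of members of \<open>U\<close>; if one is not, its complement is in \<open>U\<close> and is disjoint from \<open>A\<close>.
  So \<open>U\<close> induces an ultrafilter on the clopen subsets of \<open>S\<close>.
\<close>

lemma big_clopen_dichotomy:
  assumes emb: "c_delta_embedded X T S" and A: "clopen S (subspace T S) A"
  shows "big X U (\<lambda>x. x \<in> elts S \<longrightarrow> x \<in> elts A) \<or> big X U (\<lambda>x. x \<in> elts S \<longrightarrow> x \<notin> elts A)"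
proof -
  obtain f where f: "maps f (set_of {A}) omega"
    by (rule function_ex[of "\<lambda>x y. y = empty" "set_of {A}" omega]) (auto intro!: definable_rules)
  then have "ctble (set_of {A})" unfolding ctble_def injective_def by auto
  then have "A \<in> CO_delta S (subspace T S)"
    unfolding CO_delta_def using A by (auto intro!: exI[of _ "set_of {A}"])
  then obtain B where "B \<in> CO_delta X T" and AB: "elts A = elts B \<inter> elts S"
    using emb unfolding c_delta_embedded_def by blast
  then obtain G where G: "elts G \<noteq> {}" "ctble G" "\<And>C. C \<in> elts G \<Longrightarrow> clopen X T C"
    "elts B = (\<Inter>C\<in>elts G. elts C)"
    unfolding CO_delta_def by blast
  show ?thesis
  proof (cases "elts G \<subseteq> elts U")
    case True
    obtain g where g: "maps g G omega" "injective g G" using G(2) unfolding ctble_def by blast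
    have inj: "C = D" if "C \<in> elts G" "D \<in> elts G" "ap g C = ap g D" for C D
      using g that app_ap unfolding injective_def maps_def by metis
    \<comment> \<open>\<open>G\<close> is listed along the injection \<open>g\<close>, with \<open>X\<close> at the indices outside its range.\<close>
    obtain c where c: "maps c omega U" "\<And>k. k \<in> elts omega \<Longrightarrow>
        (ap c k \<in> elts G \<and> ap g (ap c k) = k) \<or> (\<not> (\<exists>C\<in>elts G. ap g C = k) \<and> ap c k = X)"
    proof (rule function_ex[of "\<lambda>k C. (C \<in> elts G \<and> ap g C = k) \<or> (\<not> (\<exists>C\<in>elts G. ap g C = k) \<and> C = X)" omega U])
      show "definable (\<lambda>s. (s 1 \<in> elts G \<and> ap g (s 1) = s 0) \<or> (\<not> (\<exists>C\<in>elts G. ap g C = s 0) \<and> s 1 = X))"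
        by (intro definable_rules)
      show "\<exists>C\<in>elts U. (C \<in> elts G \<and> ap g C = k) \<or> (\<not> (\<exists>C\<in>elts G. ap g C = k) \<and> C = X)" for k
        using True U_space[OF top U] by blast
    qed (use inj that in blast)+
    have "x \<in> elts A" if x: "\<forall>k\<in>elts omega. x \<in> elts (ap c k)" "x \<in> elts S" for x
    proof -
      have "x \<in> elts C" if C: "C \<in> elts G" for C
      proof -
        have k: "ap g C \<in> elts omega" using g(1) C unfolding maps_ap by blast
        then have "ap c (ap g C) = C" using c(2)[OF k] inj C by blast
        then show ?thesis using x(1) k by force
      qed
      then show ?thesis using AB G(4) x(2) by blast
    qed
    then have "big X U (\<lambda>x. x \<in> elts S \<longrightarrow> x \<in> elts A)" unfolding big_def using c(1) by blast
    then show ?thesis by blast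
  next
    case False
    then obtain C where C: "C \<in> elts G" "C \<notin> elts U" by blast
    then have "set_of (elts X - elts C) \<in> elts U" using U_ultra[OF top U G(3)] by blast
    from big_mem[OF top U this] have "big X U (\<lambda>x. x \<in> elts S \<longrightarrow> x \<notin> elts A)"
      by (rule big_mono[OF top U]) (use AB G(4) C(1) in \<open>auto simp: elts_set_of\<close>)
    then show ?thesis by blast
  qed
qed

text \<open>
  Let \<open>h\<close> be a homeomorphism of \<open>S\<close> onto a closed subspace \<open>C\<close> of a power of \<open>\<omega>\<close>.  Each coordinate of
  \<open>h\<close> splits \<open>S\<close> into countably many clopen pieces, and by the dichotomy and closure under countable
  intersections exactly one of them is large.  The indices of the large pieces form a point \<open>q\<close>
  of the power.  Large sets meet \<open>S\<close>, so every neighbourhood of \<open>q\<close> meets \<open>C\<close>, and \<open>q\<close> belongs to \<open>C\<close>.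
  Its preimage is the limit of the induced ultrafilter and hence lies in every member of \<open>U\<close>.
\<close>

lemma sigma_ultrafilter_point:
  assumes emb: "c_delta_embedded X T S" and N: "N_compact S (subspace T S)"
  shows "\<exists>x\<in>elts S. \<forall>A\<in>elts U. x \<in> elts A"
proof -
  note big_mono = big_mono[OF top U] and big_conj = big_conj[OF top U \<open>CMC\<close>]
  let ?P = "\<lambda>J. power_topology omega (discrete omega) J"
  obtain J C h g where C: "closed_in (power_space omega J) (?P J) C"
    and h: "continuous h S (subspace T S) C (subspace (?P J) C)"
    and g: "continuous g C (subspace (?P J) C) S (subspace T S)"
    and gh: "\<And>x. x \<in> elts S \<Longrightarrow> app g (app h x) = x" and hg: "\<And>y. y \<in> elts C \<Longrightarrow> app h (app g y) = y"
    using N unfolding N_compact_def homeomorphic_def by blast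
  have hC: "ap h x \<in> elts C" if "x \<in> elts S" for x using h that unfolding continuous_iff maps_ap by blast
  have gS: "ap g x \<in> elts S" if "x \<in> elts C" for x using g that unfolding continuous_iff maps_ap by blast
  have gh: "ap g (ap h x) = x" if "x \<in> elts S" for x
    using gh[OF that] hC[OF that] app_ap g h that unfolding continuous_iff maps_def by metis
  have hg: "ap h (ap g x) = x" if "x \<in> elts C" for x
    using hg[OF that] gS[OF that] app_ap g h that unfolding continuous_iff maps_def by metis
  have CJ: "maps y J omega" if "y \<in> elts C" for y
    using C that unfolding closed_in_def by auto
  have hJ: "ap (ap h x) j \<in> elts omega" if "x \<in> elts S" "j \<in> elts J" for x j
    using CJ[OF hC] that unfolding maps_ap by blast
  \<comment> \<open>Large sets meet \<open>S\<close>, since the complement of \<open>S\<close> is not large.\<close>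
  have meets: "\<exists>x\<in>elts S. Q x" if "big X U (\<lambda>x. x \<in> elts S \<longrightarrow> Q x)" for Q
    using S big_mono[OF that, of "\<lambda>x. x \<notin> elts S"] by blast
  \<comment> \<open>A condition on one coordinate of \<open>h\<close> and its negation both define open subsets of \<open>S\<close>.\<close>
  have pre: "belongs {x \<in> elts S. P (ap (ap h x) j)} (subspace T S)"
    if j: "j \<in> elts J" and P: "definable (\<lambda>s. P (s 0))" for j P
  proof -
    obtain W where W: "W \<in> elts (?P J)" "elts W = {y \<in> elts (power_space omega J). P (ap y j)}"
      using coordinate_open[of j J P, OF j P] unfolding belongs_def by blast
    have "set_of (elts W \<inter> elts C) \<in> elts (subspace (?P J) C)"
      unfolding elts_subspace using W(1) by (auto simp: elts_set_of)
    then have "belongs {x \<in> elts S. ap h x \<in> elts W \<inter> elts C} (subspace T S)"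
      using h unfolding continuous_iff by (auto simp: elts_set_of)
    moreover have "{x \<in> elts S. ap h x \<in> elts W \<inter> elts C} = {x \<in> elts S. P (ap (ap h x) j)}"
      using hC CJ W(2) by auto
    ultimately show ?thesis by simp
  qed
  have dich: "big X U (\<lambda>x. x \<in> elts S \<longrightarrow> ap (ap h x) j = m) \<or> big X U (\<lambda>x. x \<in> elts S \<longrightarrow> ap (ap h x) j \<noteq> m)"
    if j: "j \<in> elts J" for j m
  proof -
    obtain A where A: "A \<in> elts (subspace T S)" "elts A = {x \<in> elts S. ap (ap h x) j = m}"
      using pre[of j "\<lambda>y. y = m", OF j definable_eq[OF definable_term_var definable_term_const]] unfolding belongs_def by blast
    moreover have "elts S - elts A = {x \<in> elts S. ap (ap h x) j \<noteq> m}" using A(2) by auto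
    ultimately have "clopen S (subspace T S) A"
      using pre[of j "\<lambda>y. y \<noteq> m", OF j definable_not[OF definable_eq[OF definable_term_var definable_term_const]]]
      unfolding clopen_iff by auto
    from big_clopen_dichotomy[OF emb this] show ?thesis
      using A(2) by (auto intro: big_mono)
  qed
  obtain q where q: "maps q J omega" "\<And>j. j \<in> elts J \<Longrightarrow> big X U (\<lambda>x. x \<in> elts S \<longrightarrow> ap (ap h x) j = ap q j)"
  proof (rule function_ex[of "\<lambda>j m. big X U (\<lambda>x. x \<in> elts S \<longrightarrow> ap (ap h x) j = m)" J omega])
    show "definable (\<lambda>s. big X U (\<lambda>x. x \<in> elts S \<longrightarrow> ap (ap h x) (s 0) = s 1))"
      by (intro definable_big definable_rules)
  next
    fix j assume j: "j \<in> elts J"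
    show "\<exists>m\<in>elts omega. big X U (\<lambda>x. x \<in> elts S \<longrightarrow> ap (ap h x) j = m)"
    proof (rule ccontr)
      assume "\<not> ?thesis"
      then have "\<And>m. m \<in> elts omega \<Longrightarrow> big X U (\<lambda>x. x \<in> elts S \<longrightarrow> ap (ap h x) j \<noteq> m)"
        using dich[OF j] by blast
      then have "big X U (\<lambda>x. \<forall>m\<in>elts omega. x \<in> elts S \<longrightarrow> ap (ap h x) j \<noteq> m)"
        by (intro big_countable[OF top U \<open>CMC\<close>] definable_rules)
      then have "big X U (\<lambda>x. x \<notin> elts S)" by (rule big_mono) (use hJ j in blast)
      then show False using S by blast
    qed
  next
    fix j m n
    assume *: "big X U (\<lambda>x. x \<in> elts S \<longrightarrow> ap (ap h x) j = m)" "big X U (\<lambda>x. x \<in> elts S \<longrightarrow> ap (ap h x) j = n)"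
    have "big X U (\<lambda>x. (x \<in> elts S \<longrightarrow> ap (ap h x) j = m) \<and> (x \<in> elts S \<longrightarrow> ap (ap h x) j = n))"
      by (intro big_conj definable_rules *)
    then have "big X U (\<lambda>x. x \<in> elts S \<longrightarrow> m = n)" by (rule big_mono) metis
    from meets[OF this] show "m = n" by blast
  qed (use that in blast)
  have near: "big X U (\<lambda>x. x \<in> elts S \<longrightarrow> (\<forall>j\<in>elts K. ap (ap h x) j = ap q j))"
    if "fin K" "elts K \<subseteq> elts J" for K
  proof -
    have "big X U (\<lambda>x. \<forall>j\<in>elts K. x \<in> elts S \<longrightarrow> ap (ap h x) j = ap q j)"
      by (rule big_fin[OF top U \<open>CMC\<close> _ that(1)]) (use that(2) q(2) in \<open>auto intro!: definable_rules\<close>)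
    then show ?thesis by (rule big_mono) blast
  qed
  have qC: "q \<in> elts C"
  proof (rule ccontr)
    assume "q \<notin> elts C"
    obtain W where W: "W \<in> elts (?P J)" "elts W = elts (power_space omega J) - elts C"
      using C elts_set_of[OF is_set_Diff] unfolding closed_in_def by blast
    then have "q \<in> elts W" using q(1) \<open>q \<notin> elts C\<close> by auto
    then have "agree_nbhd J W q" using W(1) unfolding elts_power_topology by blast
    then obtain K where K: "fin K" "elts K \<subseteq> elts J"
      "\<And>y. maps y J omega \<Longrightarrow> \<forall>j\<in>elts K. ap y j = ap q j \<Longrightarrow> y \<in> elts W"
      unfolding agree_nbhd_def by blast
    obtain x where "x \<in> elts S" "\<forall>j\<in>elts K. ap (ap h x) j = ap q j"
      using meets[OF near[OF K(1,2)]] by blast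
    then have "ap h x \<in> elts W" "ap h x \<in> elts C" using K(3) CJ hC by blast+
    then show False using W(2) by blast
  qed
  have "ap g q \<in> elts A" if A: "A \<in> elts U" for A
  proof (rule ccontr)
    assume nA: "ap g q \<notin> elts A"
    \<comment> \<open>The complement \<open>D\<close> of \<open>A\<close> would be a neighbourhood of the limit, whereas \<open>A\<close> is large.\<close>
    obtain D where D: "D \<in> elts T" "elts D = elts X - elts A"
      using U_clopen[OF top U A] unfolding clopen_iff belongs_def by blast
    have SX: "elts S \<subseteq> elts X" using emb unfolding c_delta_embedded_def by blast
    have "set_of (elts D \<inter> elts S) \<in> elts (subspace T S)"
      unfolding elts_subspace using D(1) by (auto simp: elts_set_of)
    then have "belongs {y \<in> elts C. ap g y \<in> elts D \<inter> elts S} (subspace (?P J) C)"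
      using g unfolding continuous_iff by (auto simp: elts_set_of)
    then obtain W where W: "W \<in> elts (?P J)" "elts W \<inter> elts C = {y \<in> elts C. ap g y \<in> elts D \<inter> elts S}"
      unfolding belongs_def elts_subspace by auto
    have "q \<in> elts W" using W(2) qC nA gS[OF qC] D(2) SX by auto
    then have "agree_nbhd J W q" using W(1) unfolding elts_power_topology by blast
    then obtain K where K: "fin K" "elts K \<subseteq> elts J"
      "\<And>y. maps y J omega \<Longrightarrow> \<forall>j\<in>elts K. ap y j = ap q j \<Longrightarrow> y \<in> elts W"
      unfolding agree_nbhd_def by blast
    have "big X U (\<lambda>x. x \<in> elts A \<and> (x \<in> elts S \<longrightarrow> (\<forall>j\<in>elts K. ap (ap h x) j = ap q j)))"
      by (intro big_conj definable_rules near[OF K(1,2)] big_mem[OF top U A])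
    then have "big X U (\<lambda>x. x \<in> elts S \<longrightarrow> x \<in> elts A \<and> (\<forall>j\<in>elts K. ap (ap h x) j = ap q j))"
      by (rule big_mono) blast
    from meets[OF this] obtain x where x: "x \<in> elts S" "x \<in> elts A" "\<forall>j\<in>elts K. ap (ap h x) j = ap q j"
      by blast
    then have "ap h x \<in> elts W \<inter> elts C" using K(3) CJ hC by blast
    then have "x \<in> elts D" using W(2) gh[OF x(1)] by auto
    then show False using D(2) x(2) by blast
  qed
  then show ?thesis using gS[OF qC] by blast
qed

end
end

section \<open>Embedding into a power of the natural numbers\<close>

context membership begin

definition one :: 'v where
  "one = succ empty"

end

context ZF begin

lemma one_omega [simp]: "one \<in> elts omega"
  unfolding one_def by (intro omega_succ omega_0)

lemma one_ne_empty [simp]: "one \<noteq> empty" "empty \<noteq> one"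
  unfolding one_def by (metis elts_insert elts_empty insert_not_empty)+

lemma zero_dimensionalD:
  assumes "zero_dimensional X T" "V \<in> elts T" "x \<in> elts V"
  obtains C where "clopen X T C" "x \<in> elts C" "elts C \<subseteq> elts V"
proof -
  obtain F where "elts F \<subseteq> {C. clopen X T C}" "elts V = (\<Union>B\<in>elts F. elts B)"
    using assms(1,2) unfolding zero_dimensional_def is_base_def by blast
  then show thesis using that assms(3) by blast
qed

lemma continuous_omega_indicator:
  assumes top: "topological_space X T" and C: "clopen X T C"
  obtains f where "continuous_omega X T f"
    "\<And>x. x \<in> elts X \<Longrightarrow> ap f x = (if x \<in> elts C then one else empty)"
proof -
  obtain f where f: "maps f X omega" "\<And>x. x \<in> elts X \<Longrightarrow>
     (x \<in> elts C \<and> ap f x = one) \<or> (x \<notin> elts C \<and> ap f x = empty)"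
  proof (rule function_ex[of "\<lambda>x y. (x \<in> elts C \<and> y = one) \<or> (x \<notin> elts C \<and> y = empty)" X omega])
    show "\<exists>y\<in>elts omega. (x \<in> elts C \<and> y = one) \<or> (x \<notin> elts C \<and> y = empty)" for x
      by (cases "x \<in> elts C") auto
  qed (use that in \<open>auto intro!: definable_rules\<close>)
  have fx: "ap f x = (if x \<in> elts C then one else empty)" if "x \<in> elts X" for x
    using f(2)[OF that] by auto
  have "continuous_omega X T f" unfolding continuous_omega_def
  proof (intro conjI f(1) ballI)
    fix n assume "n \<in> elts omega"
    have CX: "elts C \<subseteq> elts X" "C \<in> elts T" "belongs (elts X - elts C) T"
      using C unfolding clopen_iff by auto
    consider "n = one" | "n = empty" | "n \<noteq> one" "n \<noteq> empty" by blast
    then show "belongs {x \<in> elts X. ap f x = n} T"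
    proof cases
      case 1
      have "{x \<in> elts X. ap f x = n} = elts C" using fx CX unfolding 1 by (auto split: if_splits)
      then show ?thesis using CX by simp
    next
      case 2
      have "{x \<in> elts X. ap f x = n} = elts X - elts C" using fx CX unfolding 2 by (auto split: if_splits)
      then show ?thesis using CX by simp
    next
      case 3
      have "{x \<in> elts X. ap f x = n} = elts empty" using fx 3 by (auto split: if_splits)
      then show ?thesis using open_empty[OF top] belongs_elts by metis
    qed
  qed
  then show thesis using that fx by blast
qed

lemma continuous_omega_fibre_clopen:
  assumes top: "topological_space X T" and f: "continuous_omega X T f" and n: "n \<in> elts omega"
    and C: "elts C = {x \<in> elts X. ap f x = n}"
  shows "clopen X T C"
proof -
  have "belongs (elts X - elts C) T"
  proof (rule open_local[OF top is_set_Diff])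
    fix x assume x: "x \<in> elts X - elts C"
    then have "ap f x \<in> elts omega" using f unfolding continuous_omega_def maps_ap by blast
    then obtain V where "V \<in> elts T" "elts V = {y \<in> elts X. ap f y = ap f x}"
      using f unfolding continuous_omega_def belongs_def by blast
    then show "\<exists>V\<in>elts T. x \<in> elts V \<and> elts V \<subseteq> elts X - elts C"
      using x C by (intro bexI[of _ V]) auto
  qed
  moreover have "belongs (elts C) T" using f n unfolding C continuous_omega_def by blast
  ultimately show ?thesis using C unfolding clopen_iff by (metis belongs_elts mem_Collect_eq subsetI)
qed

lemma definable_continuous_omega:
  "definable_term a \<Longrightarrow> definable (\<lambda>s. continuous_omega X T (a s))"
  by (rule definable_subst1[of "continuous_omega X T"]) (unfold continuous_omega_def, intro definable_rules definable_belongs)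

lemma definable_clopen:
  "definable_term a \<Longrightarrow> definable (\<lambda>s. clopen X T (a s))"
proof (rule definable_subst1[of "clopen X T"])
  have "definable (\<lambda>s. s 0 \<in> elts T \<and> elts (s 0) \<subseteq> elts X \<and> belongs {x \<in> elts X. x \<notin> elts (s 0)} T)"
    by (intro definable_rules definable_belongs)
  then show "definable (\<lambda>s. clopen X T (s 0))" unfolding clopen_iff set_diff_eq .
qed

lemma elts_triple [simp]: "elts (set_of {a, b, c}) = {a, b, c}"
  using elts_insert[of a "set_of {b, c}"] by simp

text \<open>
  A point \<open>p\<close> of the closure of the image of \<open>X\<close> under evaluation prescribes a value for every
  continuous \<open>f : X \<rightarrow> \<omega>\<close>, and the prescriptions for finitely many \<open>f\<close> are met by a common point of
  \<open>X\<close>.  The clopen sets that include a prescribed fibre therefore form a filter.  The prescribed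
  value of an indicator function decides the corresponding clopen set, and every \<open>f\<close> has a fibre in
  the filter by definition.
\<close>

lemma limit_point_ultrafilter:
  assumes top: "topological_space X T" and J: "elts J = {f. continuous_omega X T f}"
    and dense: "\<And>K. fin K \<Longrightarrow> elts K \<subseteq> elts J \<Longrightarrow> \<exists>x\<in>elts X. \<forall>f\<in>elts K. ap f x = ap p f"
    and p: "maps p J omega"
    and U: "elts U = {C. clopen X T C \<and> (\<exists>f\<in>elts J. \<forall>x\<in>elts X. ap f x = ap p f \<longrightarrow> x \<in> elts C)}"
  shows "sigma_ultrafilter X T U"
proof -
  have dense1: "\<exists>x\<in>elts X. ap f x = ap p f" if "f \<in> elts J" for f
    using dense[OF fin_single[of f]] that by simp
  have dense3: "\<exists>x\<in>elts X. ap f x = ap p f \<and> ap g x = ap p g \<and> ap h x = ap p h"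
    if "f \<in> elts J" "g \<in> elts J" "h \<in> elts J" for f g h
    using dense[OF fin_insert[OF fin_insert[OF fin_single[of h], of g], of f]] that by simp
  have clopen_space: "clopen X T X"
    unfolding clopen_iff using open_space[OF top] open_empty[OF top] by (metis Diff_cancel belongs_elts elts_empty order_refl)
  have fibre: "belongs {x \<in> elts X. ap f x = ap p f} U" if f: "f \<in> elts J" for f
  proof -
    have pf: "ap p f \<in> elts omega" using p f unfolding maps_ap by blast
    then obtain C where C: "elts C = {x \<in> elts X. ap f x = ap p f}"
      using f J unfolding continuous_omega_def belongs_def by blast
    then have "clopen X T C" using continuous_omega_fibre_clopen[OF top _ pf C] f J by blast
    then have "C \<in> elts U" unfolding U using f C by blast
    then show ?thesis using C by (metis belongs_elts)
  qed
  show ?thesis unfolding sigma_ultrafilter_def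
  proof (intro conjI ballI allI impI)
    show "clopen X T C" if "C \<in> elts U" for C using that unfolding U by blast
    show "empty \<notin> elts U" using dense1 unfolding U by force
    show "X \<in> elts U"
    proof -
      obtain f where "continuous_omega X T f" using continuous_omega_indicator[OF top clopen_space] by blast
      then show ?thesis unfolding U J using clopen_space by blast
    qed
  next
    fix C D assume CD: "C \<in> elts U" "D \<in> elts U"
    then have clo: "clopen X T C" "clopen X T D" unfolding U by blast+
    let ?I = "set_of (elts C \<inter> elts D)"
    have I: "elts ?I = elts C \<inter> elts D" by (rule elts_set_of) simp
    have "belongs (elts X - elts ?I) T"
    proof (rule open_local[OF top is_set_Diff])
      fix x assume x: "x \<in> elts X - elts ?I"
      obtain A B where "A \<in> elts T" "elts A = elts X - elts C" "B \<in> elts T" "elts B = elts X - elts D"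
        using clo unfolding clopen_iff belongs_def by blast
      then show "\<exists>V\<in>elts T. x \<in> elts V \<and> elts V \<subseteq> elts X - elts ?I"
        using x unfolding I by (cases "x \<in> elts C") (auto intro: bexI[of _ A] bexI[of _ B])
    qed
    moreover have "?I \<in> elts T"
      using open_Int[OF top] clo unfolding clopen_iff by (simp add: belongs_set_of)
    ultimately have cI: "clopen X T ?I" using clo I unfolding clopen_iff by auto
    obtain h where h: "continuous_omega X T h"
      "\<And>x. x \<in> elts X \<Longrightarrow> ap h x = (if x \<in> elts ?I then one else empty)"
      using continuous_omega_indicator[OF top cI] by blast
    obtain f where f: "f \<in> elts J" "\<And>x. x \<in> elts X \<Longrightarrow> ap f x = ap p f \<Longrightarrow> x \<in> elts C"
      using CD(1) unfolding U by blast
    obtain g where g: "g \<in> elts J" "\<And>x. x \<in> elts X \<Longrightarrow> ap g x = ap p g \<Longrightarrow> x \<in> elts D"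
      using CD(2) unfolding U by blast
    have hJ: "h \<in> elts J" using h(1) J by blast
    obtain x where x: "x \<in> elts X" "ap f x = ap p f" "ap g x = ap p g" "ap h x = ap p h"
      using dense3[OF f(1) g(1) hJ] by blast
    then have "ap p h = one" using f(2) g(2) h(2) I by simp
    then have "\<forall>x\<in>elts X. ap h x = ap p h \<longrightarrow> x \<in> elts ?I" using h(2) by auto
    then have "?I \<in> elts U" unfolding U using cI hJ by blast
    then show "belongs (elts C \<inter> elts D) U" by (simp add: belongs_set_of)
  next
    fix C assume C: "clopen X T C"
    obtain h where h: "continuous_omega X T h"
      "\<And>x. x \<in> elts X \<Longrightarrow> ap h x = (if x \<in> elts C then one else empty)"
      using continuous_omega_indicator[OF top C] by blast
    have hJ: "h \<in> elts J" using h(1) J by blast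
      obtain x where x: "x \<in> elts X" "ap h x = ap p h" using dense1[OF hJ] by blast
    show "C \<in> elts U \<or> set_of (elts X - elts C) \<in> elts U"
    proof (cases "x \<in> elts C")
      case True
      then have "\<forall>y\<in>elts X. ap h y = ap p h \<longrightarrow> y \<in> elts C" using x h(2) one_ne_empty by metis
      then show ?thesis unfolding U using C hJ by blast
    next
      case False
      obtain D where D: "elts D = elts X - elts C" "D \<in> elts T"
        using C unfolding clopen_iff belongs_def by blast
      then have "elts X - elts D = elts C" using C unfolding clopen_iff by auto
      then have "clopen X T D" using D C unfolding clopen_iff by auto
      moreover have "\<forall>y\<in>elts X. ap h y = ap p h \<longrightarrow> y \<in> elts D" using False x h(2) one_ne_empty D(1) by auto
      ultimately have "D \<in> elts U" unfolding U using hJ by blast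
      then show ?thesis using D(1) by (metis set_of_elts)
    qed
  next
    fix f assume "continuous_omega X T f"
    then have "f \<in> elts J" using J by blast
    then show "\<exists>n\<in>elts omega. belongs {x \<in> elts X. ap f x = n} U"
      using fibre p unfolding maps_ap by blast
  qed
qed

text \<open>
  The evaluation map \<open>e\<close> sends \<open>x\<close> to the family of all values \<open>f x\<close>, where \<open>f\<close> runs over the set \<open>J\<close>
  of continuous functions from \<open>X\<close> to \<open>\<omega>\<close>.  Indicator functions of clopen sets separate points
  and make it open onto its image.  If \<open>p\<close> is in the closure of the image, a point \<open>x\<close> of the ultrafilter
  given by \<open>p\<close> lies in all fibres prescribed by \<open>p\<close>, that is \<open>p = e x\<close>; so the image is closed.
\<close>

lemma N_compactI:
  assumes zd: "zero_dimensional X T" and T1: "T1_space X T"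
    and fixed: "\<And>U. sigma_ultrafilter X T U \<Longrightarrow> \<exists>x\<in>elts X. \<forall>A\<in>elts U. x \<in> elts A"
  shows "N_compact X T"
proof -
  let ?P = "\<lambda>J. power_topology omega (discrete omega) J"
  have top: "topological_space X T" using zd unfolding zero_dimensional_def by blast
  have "is_set {f. continuous_omega X T f}"
  proof (rule sepI_sub[of _ "power_space omega X"])
    show "definable (\<lambda>s. continuous_omega X T (s 0))" by (intro definable_continuous_omega definable_term_var)
  qed (simp add: continuous_omega_def)
  then obtain J where J: "elts J = {f. continuous_omega X T f}" unfolding is_set_def by blast
  have J_omega: "ap f x \<in> elts omega" if "f \<in> elts J" "x \<in> elts X" for f x
    using that J unfolding continuous_omega_def maps_ap by blast
  have clopen_space: "clopen X T X"
    unfolding clopen_iff using open_space[OF top] open_empty[OF top] by (metis Diff_cancel belongs_elts elts_empty order_refl)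
  obtain e where e: "maps e X (power_space omega J)"
    "\<And>x. x \<in> elts X \<Longrightarrow> \<forall>f\<in>elts J. ap (ap e x) f = ap f x"
  proof (rule function_ex[of "\<lambda>x y. \<forall>f\<in>elts J. ap y f = ap f x" X "power_space omega J"])
    show "definable (\<lambda>s. \<forall>f\<in>elts J. ap (s 1) f = ap f (s 0))" by (intro definable_rules)
    show "\<exists>y\<in>elts (power_space omega J). \<forall>f\<in>elts J. ap y f = ap f x" if x: "x \<in> elts X" for x
    proof -
      obtain y where "maps y J omega" "\<And>f. f \<in> elts J \<Longrightarrow> ap y f = ap f x"
        by (rule function_ex[of "\<lambda>f n. n = ap f x" J omega]) (use J_omega x in \<open>auto intro!: definable_rules\<close>)
      then show ?thesis by auto
    qed
    show "y = z" if "y \<in> elts (power_space omega J)" "z \<in> elts (power_space omega J)"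
      "\<forall>f\<in>elts J. ap y f = ap f x" "\<forall>f\<in>elts J. ap z f = ap f x" for x y z
      using that by (intro function_ext[of y J z]) (auto simp: maps_def)
  qed (use that in blast)
  have ex: "maps (ap e x) J omega" if "x \<in> elts X" for x
    using e(1) that unfolding maps_ap[of e] by auto
  have e_inj: "x = y" if xy: "x \<in> elts X" "y \<in> elts X" "ap e x = ap e y" for x y
  proof (rule ccontr)
    assume "x \<noteq> y"
    then obtain V where V: "V \<in> elts T" "x \<in> elts V" "y \<notin> elts V"
      using T1 xy unfolding T1_space_def by blast
    obtain C where C: "clopen X T C" "x \<in> elts C" "elts C \<subseteq> elts V"
      using zero_dimensionalD[OF zd V(1,2)] .
    obtain f where f: "continuous_omega X T f"
      "\<And>x. x \<in> elts X \<Longrightarrow> ap f x = (if x \<in> elts C then one else empty)"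
      using continuous_omega_indicator[OF top C(1)] by blast
    then have "ap f x = ap f y" using e(2)[OF xy(1)] e(2)[OF xy(2)] xy(3) J by auto
    then show False using f(2) xy V C by (auto split: if_splits)
  qed
  have "is_set {y. maps y J omega \<and> (\<exists>x\<in>elts X. y = ap e x)}"
    by (rule sepI_sub[of _ "power_space omega J"]) (auto intro!: definable_rules)
  then obtain C where "elts C = {y. maps y J omega \<and> (\<exists>x\<in>elts X. y = ap e x)}" unfolding is_set_def by blast
  then have C: "elts C = ap e ` elts X" using ex by auto
  obtain g where g: "maps g C X" "\<And>y. y \<in> elts C \<Longrightarrow> y = ap e (ap g y)"
    by (rule function_ex[of "\<lambda>y x. y = ap e x" C X]) (use C e_inj in \<open>auto intro!: definable_rules\<close>)
  have gX: "ap g y \<in> elts X" if "y \<in> elts C" for y using g(1) that unfolding maps_ap by blast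
  have ge: "ap g (ap e x) = x" if "x \<in> elts X" for x
    using e_inj[OF gX that] g(2) C that by (metis imageI)
  have eC: "maps e X C" using e(1) C unfolding maps_ap by blast

  have "closed_in (power_space omega J) (?P J) C"
  proof -
    obtain W where W: "elts W = elts (power_space omega J) - elts C"
      using is_set_Diff unfolding is_set_def by blast
    have "agree_nbhd J W p" if p: "p \<in> elts W" for p
    proof (rule ccontr)
      assume far: "\<not> agree_nbhd J W p"
      have pJ: "maps p J omega" using p W by simp
      have dense: "\<exists>x\<in>elts X. \<forall>f\<in>elts K. ap f x = ap p f" if K: "fin K" "elts K \<subseteq> elts J" for K
      proof -
        obtain y where y: "maps y J omega" "\<forall>f\<in>elts K. ap y f = ap p f" "y \<notin> elts W"
          using far K unfolding agree_nbhd_def by blast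
        then obtain x where "x \<in> elts X" "y = ap e x" using W C by auto
        then show ?thesis using e(2) y(2) K(2) by (metis subsetD)
      qed
      have "is_set {A. clopen X T A \<and> (\<exists>f\<in>elts J. \<forall>x\<in>elts X. ap f x = ap p f \<longrightarrow> x \<in> elts A)}"
        by (rule sepI_sub[of _ T], intro definable_rules definable_clopen) (simp add: clopen_def)
      then obtain U where U: "elts U = {A. clopen X T A \<and> (\<exists>f\<in>elts J. \<forall>x\<in>elts X. ap f x = ap p f \<longrightarrow> x \<in> elts A)}"
        unfolding is_set_def by blast
      obtain x where x: "x \<in> elts X" "\<forall>A\<in>elts U. x \<in> elts A"
        using fixed[OF limit_point_ultrafilter[OF top J dense pJ U]] by blast
      have "ap f x = ap p f" if f: "f \<in> elts J" for f
      proof -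
        have pf: "ap p f \<in> elts omega" using pJ f unfolding maps_ap by blast
        then obtain A where A: "elts A = {x \<in> elts X. ap f x = ap p f}"
          using f J unfolding continuous_omega_def belongs_def by blast
        then have "clopen X T A" using continuous_omega_fibre_clopen[OF top _ pf A] f J by blast
        then have "A \<in> elts U" unfolding U using f A by blast
        then show ?thesis using x(2) A by blast
      qed
      then have "p = ap e x"
        using pJ ex[OF x(1)] e(2)[OF x(1)] by (intro function_ext[of p J]) (auto simp: maps_def)
      then show False using p W C x(1) by blast
    qed
    then have "W \<in> elts (?P J)" unfolding elts_power_topology using W by auto
    moreover have "elts C \<subseteq> elts (power_space omega J)" using C ex by auto
    ultimately show ?thesis unfolding closed_in_def using W by (metis set_of_elts)
  qed
  moreover have "continuous e X T C (subspace (?P J) C)"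
    unfolding continuous_iff
  proof (intro conjI ballI eC)
    fix V assume "V \<in> elts (subspace (?P J) C)"
    then obtain W where W: "W \<in> elts (?P J)" "elts V = elts W \<inter> elts C"
      unfolding elts_subspace by blast
    show "belongs {x \<in> elts X. ap e x \<in> elts V} T"
    proof (rule open_local[OF top])
      show "is_set {x \<in> elts X. ap e x \<in> elts V}" by (rule sepI) (intro definable_rules)
      fix x assume x: "x \<in> {x \<in> elts X. ap e x \<in> elts V}"
      then have "agree_nbhd J W (ap e x)" using W unfolding elts_power_topology by blast
      then obtain K where K: "fin K" "elts K \<subseteq> elts J"
        "\<And>y. maps y J omega \<Longrightarrow> \<forall>f\<in>elts K. ap y f = ap (ap e x) f \<Longrightarrow> y \<in> elts W"
        unfolding agree_nbhd_def by blast
      have "belongs {y \<in> elts X. \<forall>f\<in>elts K. ap f y = ap f x} T"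
      proof (rule finite_Int[OF open_space[OF top] open_Int[OF top] _ K(1)])
        show "definable (\<lambda>s. ap (s 0) (s 1) = ap (s 0) x)" by (intro definable_rules)
        show "belongs {y \<in> elts X. ap f y = ap f x} T" if "f \<in> elts K" for f
          using J_omega[of f x] x K(2) J that unfolding continuous_omega_def by blast
      qed
      then obtain N where N: "N \<in> elts T" "elts N = {y \<in> elts X. \<forall>f\<in>elts K. ap f y = ap f x}"
        unfolding belongs_def by blast
      have "ap e y \<in> elts V" if "y \<in> elts N" for y
      proof -
        have y: "y \<in> elts X" "\<forall>f\<in>elts K. ap f y = ap f x" using that N(2) by auto
        have "\<forall>f\<in>elts K. ap (ap e y) f = ap (ap e x) f"
          using e(2)[OF y(1)] e(2)[of x] x y(2) K(2) by (metis (no_types, lifting) mem_Collect_eq subsetD)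
        then show ?thesis using K(3)[OF ex[OF y(1)]] W(2) C y(1) by blast
      qed
      then show "\<exists>N\<in>elts T. x \<in> elts N \<and> elts N \<subseteq> {x \<in> elts X. ap e x \<in> elts V}"
        using N x by (intro bexI[of _ N]) auto
    qed
  qed
  moreover have "continuous g C (subspace (?P J) C) X T"
    unfolding continuous_iff
  proof (intro conjI ballI g(1))
    fix V assume V: "V \<in> elts T"
    \<comment> \<open>The union of the subbasic sets given by the functions whose fibre over 1 is included in \<open>V\<close>.\<close>
    let ?Q = "\<lambda>q. maps q J omega \<and> (\<exists>f\<in>elts J. ap q f = one \<and>
      (\<forall>x\<in>elts X. ap f x = one \<longrightarrow> x \<in> elts V))"
    have "is_set {q. ?Q q}"
      by (rule sepI_sub[of _ "power_space omega J"]) (auto intro!: definable_rules)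
    then obtain W where W: "elts W = {q. ?Q q}" unfolding is_set_def by blast
    have "agree_nbhd J W q" if q: "q \<in> elts W" for q
    proof -
      obtain f where f: "f \<in> elts J" "ap q f = one"
        "\<forall>x\<in>elts X. ap f x = one \<longrightarrow> x \<in> elts V" using q unfolding W by blast
      show ?thesis unfolding agree_nbhd_def
      proof (intro exI[of _ "set_of {f}"] conjI fin_single allI impI)
        show "q' \<in> elts W" if "maps q' J omega \<and> (\<forall>j\<in>elts (set_of {f}). ap q' j = ap q j)" for q'
          unfolding W using f that by auto
      qed (simp add: f(1))
    qed
    then have WP: "W \<in> elts (?P J)" unfolding elts_power_topology using W by auto
    have eW: "ap e x \<in> elts W \<longleftrightarrow> x \<in> elts V" if x: "x \<in> elts X" for x
    proof
      assume "ap e x \<in> elts W"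
      then show "x \<in> elts V" using e(2)[OF x] x unfolding W by auto
    next
      assume "x \<in> elts V"
      then obtain D where D: "clopen X T D" "x \<in> elts D" "elts D \<subseteq> elts V"
        using zero_dimensionalD[OF zd V] by blast
      obtain f where f: "continuous_omega X T f"
        "\<And>x. x \<in> elts X \<Longrightarrow> ap f x = (if x \<in> elts D then one else empty)"
        using continuous_omega_indicator[OF top D(1)] by blast
      have "\<forall>x\<in>elts X. ap f x = one \<longrightarrow> x \<in> elts V" using f(2) one_ne_empty D(3) by auto
      moreover have "ap (ap e x) f = one" using e(2)[OF x] f D(2) x J by simp
      ultimately show "ap e x \<in> elts W" unfolding W using ex[OF x] f(1) J by blast
    qed
    have "{y \<in> elts C. ap g y \<in> elts V} = elts W \<inter> elts C"
      using eW gX g(2) by (metis (no_types, lifting) Collect_cong Int_def)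
    moreover have "set_of (elts W \<inter> elts C) \<in> elts (subspace (?P J) C)"
      unfolding elts_subspace using WP by (auto simp: elts_set_of)
    ultimately show "belongs {y \<in> elts C. ap g y \<in> elts V} (subspace (?P J) C)"
      by (simp add: belongs_set_of)
  qed
  moreover have "\<forall>x\<in>elts X. app g (app e x) = x"
    using ge app_ap eC g(1) C unfolding maps_def by (metis (no_types, lifting) imageI)
  moreover have "\<forall>y\<in>elts C. app e (app g y) = y"
    using g(2) app_ap eC g(1) gX unfolding maps_def by metis
  moreover have "elts J \<noteq> {}"
    using continuous_omega_indicator[OF top clopen_space] J by blast
  ultimately show ?thesis unfolding N_compact_def homeomorphic_def by blast
qed

section \<open>Countable unions\<close>
text \<open>
  If the complement of every \<open>S\<^sub>n\<close> were large, then so would be their intersection, which is empty.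
  Hence some \<open>S\<^sub>n\<close> meets all large sets, and the ultrafilter has a point there.
\<close>

lemma N_compact_countable_union:
  assumes zd: "zero_dimensional X T" and T1: "T1_space X T" and CMC
    and emb: "\<And>n. n \<in> elts omega \<Longrightarrow> c_delta_embedded X T (app S n)"
    and N: "\<And>n. n \<in> elts omega \<Longrightarrow> N_compact (app S n) (subspace T (app S n))"
    and S: "is_function S omega" and X: "elts X = (\<Union>n\<in>elts omega. elts (app S n))"
  shows "N_compact X T"
proof (rule N_compactI[OF zd T1])
  fix U assume U: "sigma_ultrafilter X T U"
  have top: "topological_space X T" using zd unfolding zero_dimensional_def by blast
  have "\<exists>n\<in>elts omega. \<not> big X U (\<lambda>x. x \<notin> elts (ap S n))"
  proof (rule ccontr)
    assume "\<not> ?thesis"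
    then have "big X U (\<lambda>x. \<forall>n\<in>elts omega. x \<notin> elts (ap S n))"
      by (intro big_countable[OF top U \<open>CMC\<close>] definable_rules) blast
    from big_nonempty[OF top U this] show False using X app_ap[OF S] by auto
  qed
  then obtain n where n: "n \<in> elts omega" "\<not> big X U (\<lambda>x. x \<notin> elts (app S n))"
    using app_ap[OF S] by auto
  have "\<exists>x\<in>elts (app S n). \<forall>A\<in>elts U. x \<in> elts A"
    by (rule sigma_ultrafilter_point[OF top U \<open>CMC\<close> n(2) emb[OF n(1)] N[OF n(1)]])
  then show "\<exists>x\<in>elts X. \<forall>A\<in>elts U. x \<in> elts A" using X n(1) by blast
qed

end

theorem theorem5p17:
  fixes E :: "'v \<Rightarrow> 'v \<Rightarrow> bool"
    and X T S :: 'v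
  assumes "ZF E"
    and "membership.zero_dimensional E X T"
    and "membership.T1_space E X T"
    and "membership.is_function E S (membership.omega E)"
    and "\<forall>n \<in> membership.elts E (membership.omega E).
           membership.elts E (membership.app E S n) \<subseteq> membership.elts E X \<and>
           membership.c_delta_embedded E X T (membership.app E S n) \<and>
           membership.N_compact E (membership.app E S n)
             (membership.subspace E T (membership.app E S n))"
    and "membership.elts E X =
           (\<Union>n \<in> membership.elts E (membership.omega E).
              membership.elts E (membership.app E S n))"
    and "membership.CMC E"
  shows "membership.N_compact E X T"
proof -
  interpret ZF E by fact
  show ?thesis
    by (rule N_compact_countable_union[where S = S]) (use assms in auto)
qed

end
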